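(* Let $R$ be a unital commutative ring and let $(\mathcal B,\mathcal L,\theta,\mathcal I,\mathcal J)$ be a relative generalized Boolean dynamical system, with associated generalized Boolean dynamical system $(\tilde{\mathcal B},\mathcal L,\tilde\theta,\tilde{\mathcal I})$ (defined in the context). Then $$L_R(\mathcal B,\mathcal L,\theta,\mathcal I,\mathcal J)\cong L_R(\tilde{\mathcal B},\mathcal L,\tilde\theta,\tilde{\mathcal I}).$$ The isomorphism is realized by the maps $\varphi:L_R(\mathcal B,\mathcal L,\theta,\mathcal I,\mathcal J)\to L_R(\tilde{\mathcal B},\mathcal L,\tilde\theta,\tilde{\mathcal I})$ and $\psi:L_R(\tilde{\mathcal B},\mathcal L,\tilde\theta,\tilde{\mathcal I})\to L_R(\mathcal B,\mathcal L,\theta,\mathcal I,\mathcal J)$ given on generators by $$\varphi(p_A)=p_{(A,[A]_{\mathcal J})},\qquad \varphi(s_{a,B})=s_{a,(B,[B]_{\mathcal J})}\qquad (A\in\mathcal B,\ a\in\mathcal L,\ B\in\mathcal I_a),$$ $$\psi(p_{(A,[B]_{\mathcal J})})=p_A+q_C-q_D,\qquad \psi(s_{a,(A',[A']_{\mathcal J})})=s_{a,A'}\qquad ((A,[B]_{\mathcal J})\in\tilde{\mathcal B},\ a\in\mathcal L,\ A'\in\mathcal I_a)$$ (and correspondingly on the generators $s^*$), where $C,D\in\mathcal B_{\mathrm{reg}}$ are any sets such that $A\cup C=B\cup D$ and $A\cap C=\emptyset=B\cap D$.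
   Context: A generalized Boolean algebra $\mathcal B$ is a distributive lattice with relative complements and a least element $\emptyset$; write $\cup,\cap,\setminus,\subseteq$ for join, meet, relative complement and order. Morphisms preserve $\emptyset$ and all operations. An ideal is a nonempty subset closed under $\cup$ and under $\cap$ with arbitrary elements of $\mathcal B$. For an ideal $\mathcal K$ of $\mathcal B$, $[A]_{\mathcal K}$ is the class of $A$ under $A\sim B\iff A\cup U=B\cup U$ for some $U\in\mathcal K$; the quotient $\mathcal B/\mathcal K$ is a generalized Boolean algebra. A relative generalized Boolean dynamical system $(\mathcal B,\mathcal L,\theta,\mathcal I,\mathcal J)$ consists of a generalized Boolean algebra $\mathcal B$, a set $\mathcal L$, morphisms $\theta_\alpha:\mathcal B\to\mathcal B$ ($\alpha\in\mathcal L$), ideals $\mathcal I_\alpha$ of $\mathcal B$ ($\alpha\in\mathcal L$) with $\{A\in\mathcal B:A\subseteq\theta_\alpha(B)\text{ for some }B\in\mathcal B\}\subseteq\mathcal I_\alpha$, and an ideal $\mathcal J$ of $\mathcal B_{\mathrm{reg}}$, where $\Delta_A=\{\alpha\in\mathcal L:\theta_\alpha(A)\neq\emptyset\}$ and $\mathcal B_{\mathrm{reg}}=\{A\in\mathcal B:0<|\Delta_B|<\infty\text{ for all }\emptyset\neq B\subseteq A\}$ (an ideal of $\mathcal B$). A generalized Boolean dynamical system is a quadruple $(\mathcal B,\mathcal L,\theta,\mathcal I)$, understood with $\mathcal J=\mathcal B_{\mathrm{reg}}$. $L_R(\mathcal B,\mathcal L,\theta,\mathcal I,\mathcal J)$ is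 the universal associative (not necessarily unital) $R$-algebra generated by $\{p_A\}_{A\in\mathcal B}\cup\{s_{\alpha,B},s_{\alpha,B}^*\}_{\alpha\in\mathcal L,B\in\mathcal I_\alpha}$ subject to: (1) $p_\emptyset=0$, $p_{A\cap A'}=p_Ap_{A'}$, $p_{A\cup A'}=p_A+p_{A'}-p_{A\cap A'}$; (2) $p_As_{\alpha,B}=s_{\alpha,B}p_{\theta_\alpha(A)}$ and $s_{\alpha,B}^*p_A=p_{\theta_\alpha(A)}s_{\alpha,B}^*$; (3) $s_{\alpha,B}^*s_{\alpha',B'}=\delta_{\alpha,\alpha'}p_{B\cap B'}$; (4) $s_{\alpha,B}p_{B'}=s_{\alpha,B\cap B'}$ and $p_{B'}s_{\alpha,B}^*=s_{\alpha,B\cap B'}^*$; (5) $p_A=\sum_{\alpha\in\Delta_A}s_{\alpha,\theta_\alpha(A)}s_{\alpha,\theta_\alpha(A)}^*$ for all $A\in\mathcal J$. For a generalized Boolean dynamical system, $L_R(\mathcal B,\mathcal L,\theta,\mathcal I):=L_R(\mathcal B,\mathcal L,\theta,\mathcal I,\mathcal B_{\mathrm{reg}})$. For $|\Delta_A|<\infty$, $q_A:=p_A-\sum_{\alpha\in\Delta_A}s_{\alpha,\theta_\alpha(A)}s_{\alpha,\theta_\alpha(A)}^*$. The associated system: $\tilde{\mathcal B}=\{(A,[B]_{\mathcal J}):A,B\in\mathcal B,\ [A]_{\mathcal B_{\mathrm{reg}}}=[B]_{\mathcal B_{\mathrm{reg}}}\}$ with operations defined coordinatewise (on representatives in the second coordinate);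 $\tilde{\mathcal I}_\alpha=\{(A,[A]_{\mathcal J}):A\in\mathcal I_\alpha\}$; $\tilde\theta_\alpha(A,[B]_{\mathcal J})=(\theta_\alpha(A),[\theta_\alpha(A)]_{\mathcal J})$. It is taken to be a generalized Boolean dynamical system, with $\tilde{\mathcal B}_{\mathrm{reg}}=\{(A,\emptyset):A\in\mathcal B_{\mathrm{reg}}\}$. *)

theory Defs
  imports "HOL-Library.Poly_Mapping" "HOL-Algebra.Congruence"
begin

section \<open>Generalized Boolean algebras\<close>

record 'b gba = "'b partial_object" +
  bjoin :: "'b \<Rightarrow> 'b \<Rightarrow> 'b" (infixl "\<squnion>\<index>" 65)
  bmeet :: "'b \<Rightarrow> 'b \<Rightarrow> 'b" (infixl "\<sqinter>\<index>" 70)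
  bdiff :: "'b \<Rightarrow> 'b \<Rightarrow> 'b" (infixl "\<setminus>\<index>" 70)
  bzero :: "'b" ("\<emptyset>\<index>")

definition bleq :: "'b gba \<Rightarrow> 'b \<Rightarrow> 'b \<Rightarrow> bool" (infix "\<sqsubseteq>\<index>" 50) where
  "A \<sqsubseteq>\<^bsub>\<B>\<^esub> C \<longleftrightarrow> A \<sqinter>\<^bsub>\<B>\<^esub> C = A"

locale generalized_boolean_algebra =
  fixes \<B> :: "'b gba" (structure)
  assumes join_closed: "\<lbrakk>A \<in> carrier \<B>; C \<in> carrier \<B>\<rbrakk> \<Longrightarrow> A \<squnion> C \<in> carrier \<B>"
    and meet_closed: "\<lbrakk>A \<in> carrier \<B>; C \<in> carrier \<B>\<rbrakk> \<Longrightarrow> A \<sqinter> C \<in> carrier \<B>"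
    and diff_closed: "\<lbrakk>A \<in> carrier \<B>; C \<in> carrier \<B>\<rbrakk> \<Longrightarrow> A \<setminus> C \<in> carrier \<B>"
    and zero_closed: "\<emptyset> \<in> carrier \<B>"
    and join_assoc: "\<lbrakk>A \<in> carrier \<B>; C \<in> carrier \<B>; D \<in> carrier \<B>\<rbrakk>
      \<Longrightarrow> (A \<squnion> C) \<squnion> D = A \<squnion> (C \<squnion> D)"
    and meet_assoc: "\<lbrakk>A \<in> carrier \<B>; C \<in> carrier \<B>; D \<in> carrier \<B>\<rbrakk>
      \<Longrightarrow> (A \<sqinter> C) \<sqinter> D = A \<sqinter> (C \<sqinter> D)"
    and join_comm: "\<lbrakk>A \<in> carrier \<B>; C \<in> carrier \<B>\<rbrakk> \<Longrightarrow> A \<squnion> C = C \<squnion> A"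
    and meet_comm: "\<lbrakk>A \<in> carrier \<B>; C \<in> carrier \<B>\<rbrakk> \<Longrightarrow> A \<sqinter> C = C \<sqinter> A"
    and join_absorb: "\<lbrakk>A \<in> carrier \<B>; C \<in> carrier \<B>\<rbrakk> \<Longrightarrow> A \<squnion> (A \<sqinter> C) = A"
    and meet_absorb: "\<lbrakk>A \<in> carrier \<B>; C \<in> carrier \<B>\<rbrakk> \<Longrightarrow> A \<sqinter> (A \<squnion> C) = A"
    and meet_join_distrib: "\<lbrakk>A \<in> carrier \<B>; C \<in> carrier \<B>; D \<in> carrier \<B>\<rbrakk>
      \<Longrightarrow> A \<sqinter> (C \<squnion> D) = (A \<sqinter> C) \<squnion> (A \<sqinter> D)"
    and zero_least: "A \<in> carrier \<B> \<Longrightarrow> \<emptyset> \<sqsubseteq> A"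
    and diff_meet: "\<lbrakk>A \<in> carrier \<B>; C \<in> carrier \<B>\<rbrakk> \<Longrightarrow> (A \<setminus> C) \<sqinter> C = \<emptyset>"
    and diff_join: "\<lbrakk>A \<in> carrier \<B>; C \<in> carrier \<B>\<rbrakk> \<Longrightarrow> (A \<setminus> C) \<squnion> (A \<sqinter> C) = A"

definition gba_morphism :: "'b gba \<Rightarrow> 'c gba \<Rightarrow> ('b \<Rightarrow> 'c) \<Rightarrow> bool" where
  "gba_morphism \<B> \<C> f \<longleftrightarrow>
     f ` carrier \<B> \<subseteq> carrier \<C> \<and>
     f \<emptyset>\<^bsub>\<B>\<^esub> = \<emptyset>\<^bsub>\<C>\<^esub> \<and>
     (\<forall>A\<in>carrier \<B>. \<forall>C\<in>carrier \<B>.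
        f (A \<squnion>\<^bsub>\<B>\<^esub> C) = f A \<squnion>\<^bsub>\<C>\<^esub> f C \<and>
        f (A \<sqinter>\<^bsub>\<B>\<^esub> C) = f A \<sqinter>\<^bsub>\<C>\<^esub> f C \<and>
        f (A \<setminus>\<^bsub>\<B>\<^esub> C) = f A \<setminus>\<^bsub>\<C>\<^esub> f C)"

definition gba_ideal :: "'b gba \<Rightarrow> 'b set \<Rightarrow> bool" where
  "gba_ideal \<B> K \<longleftrightarrow>
     K \<noteq> {} \<and> K \<subseteq> carrier \<B> \<and>
     (\<forall>U\<in>K. \<forall>V\<in>K. U \<squnion>\<^bsub>\<B>\<^esub> V \<in> K) \<and>
     (\<forall>U\<in>K. \<forall>A\<in>carrier \<B>. U \<sqinter>\<^bsub>\<B>\<^esub> A \<in> K)"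

definition gba_class :: "'b gba \<Rightarrow> 'b set \<Rightarrow> 'b \<Rightarrow> 'b set" where
  "gba_class \<B> K A = {C \<in> carrier \<B>. \<exists>U\<in>K. A \<squnion>\<^bsub>\<B>\<^esub> U = C \<squnion>\<^bsub>\<B>\<^esub> U}"

definition gba_quotient :: "'b gba \<Rightarrow> 'b set \<Rightarrow> 'b set gba" where
  "gba_quotient \<B> K =
     \<lparr>carrier = gba_class \<B> K ` carrier \<B>,
      bjoin = (\<lambda>X Y. \<Union>A\<in>X. \<Union>C\<in>Y. gba_class \<B> K (A \<squnion>\<^bsub>\<B>\<^esub> C)),
      bmeet = (\<lambda>X Y. \<Union>A\<in>X. \<Union>C\<in>Y. gba_class \<B> K (A \<sqinter>\<^bsub>\<B>\<^esub> C)),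
      bdiff = (\<lambda>X Y. \<Union>A\<in>X. \<Union>C\<in>Y. gba_class \<B> K (A \<setminus>\<^bsub>\<B>\<^esub> C)),
      bzero = gba_class \<B> K \<emptyset>\<^bsub>\<B>\<^esub>\<rparr>"


section \<open>Relative generalized Boolean dynamical systems\<close>

definition gbds_Delta :: "'b gba \<Rightarrow> 'l set \<Rightarrow> ('l \<Rightarrow> 'b \<Rightarrow> 'b) \<Rightarrow> 'b \<Rightarrow> 'l set" where
  "gbds_Delta \<B> \<L> \<theta> A = {\<alpha> \<in> \<L>. \<theta> \<alpha> A \<noteq> \<emptyset>\<^bsub>\<B>\<^esub>}"

definition gbds_reg :: "'b gba \<Rightarrow> 'l set \<Rightarrow> ('l \<Rightarrow> 'b \<Rightarrow> 'b) \<Rightarrow> 'b set" where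
  "gbds_reg \<B> \<L> \<theta> = {A \<in> carrier \<B>. \<forall>C\<in>carrier \<B>. C \<noteq> \<emptyset>\<^bsub>\<B>\<^esub> \<and> C \<sqsubseteq>\<^bsub>\<B>\<^esub> A \<longrightarrow>
     finite (gbds_Delta \<B> \<L> \<theta> C) \<and> 0 < card (gbds_Delta \<B> \<L> \<theta> C)}"

locale relative_gbds = generalized_boolean_algebra \<B>
  for \<B> :: "'b gba" (structure) +
  fixes \<L> :: "'l set"
    and \<theta> :: "'l \<Rightarrow> 'b \<Rightarrow> 'b"
    and \<I> :: "'l \<Rightarrow> 'b set"
    and \<J> :: "'b set"
  assumes theta_morphism: "\<alpha> \<in> \<L> \<Longrightarrow> gba_morphism \<B> \<B> (\<theta> \<alpha>)"
    and ideal_I: "\<alpha> \<in> \<L> \<Longrightarrow> gba_ideal \<B> (\<I> \<alpha>)"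
    and range_subset_I:
      "\<alpha> \<in> \<L> \<Longrightarrow> {A \<in> carrier \<B>. \<exists>C\<in>carrier \<B>. A \<sqsubseteq> \<theta> \<alpha> C} \<subseteq> \<I> \<alpha>"
    and ideal_J: "gba_ideal (\<B>\<lparr>carrier := gbds_reg \<B> \<L> \<theta>\<rparr>) \<J>"


section \<open>Algebras given by generators and relations\<close>

text \<open>
  Elements of the free monoid on \<open>'g\<close>, with concatenation written additively. The type
  \<open>'g fword \<Rightarrow>\<^sub>0 'r\<close> with the convolution product of \<^theory>\<open>HOL-Library.Poly_Mapping\<close>
  is then the free unital associative \<open>'r\<close>-algebra on \<open>'g\<close>.
\<close>

datatype 'g fword = FWord (letters: "'g list")

instantiation fword :: (type) monoid_add
begin

definition zero_fword :: "'a fword" where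
  "0 = FWord []"

definition plus_fword :: "'a fword \<Rightarrow> 'a fword \<Rightarrow> 'a fword" where
  "v + w = FWord (letters v @ letters w)"

instance
  by standard (simp_all add: zero_fword_def plus_fword_def)

end

text \<open>
  The sort \<open>{comm_ring, comm_monoid_mult}\<close> is used for unital commutative rings: unlike
  \<^class>\<open>comm_ring_1\<close> it does not exclude the zero ring.
\<close>

definition free_var :: "'g \<Rightarrow> 'g fword \<Rightarrow>\<^sub>0 'r::{comm_ring, comm_monoid_mult}" where
  "free_var g = Poly_Mapping.single (FWord [g]) 1"

definition free_scale :: "'r \<Rightarrow> ('g fword \<Rightarrow>\<^sub>0 'r) \<Rightarrow> 'g fword \<Rightarrow>\<^sub>0 'r::{comm_ring, comm_monoid_mult}"
  where "free_scale r x = Poly_Mapping.map ((*) r) x"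

text \<open>The free non-unital algebra on \<open>G\<close>: no constant terms.\<close>

definition free_alg :: "'g set \<Rightarrow> ('g fword \<Rightarrow>\<^sub>0 'r::{comm_ring, comm_monoid_mult}) set" where
  "free_alg G = {x. \<forall>w\<in>Poly_Mapping.keys x. letters w \<noteq> [] \<and> set (letters w) \<subseteq> G}"

text \<open>The two-sided algebra ideal generated by all \<open>u - v\<close> with \<open>(u, v) \<in> E\<close>.\<close>

inductive_set rel_ideal ::
    "'g set \<Rightarrow> (('g fword \<Rightarrow>\<^sub>0 'r) \<times> ('g fword \<Rightarrow>\<^sub>0 'r)) set
      \<Rightarrow> ('g fword \<Rightarrow>\<^sub>0 'r::{comm_ring, comm_monoid_mult}) set"
  for G E where
  zero: "0 \<in> rel_ideal G E"
| rel: "(u, v) \<in> E \<Longrightarrow> u - v \<in> rel_ideal G E"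
| add: "x \<in> rel_ideal G E \<Longrightarrow> y \<in> rel_ideal G E \<Longrightarrow> x + y \<in> rel_ideal G E"
| scale: "x \<in> rel_ideal G E \<Longrightarrow> free_scale r x \<in> rel_ideal G E"
| mult_left: "x \<in> rel_ideal G E \<Longrightarrow> a \<in> free_alg G \<Longrightarrow> a * x \<in> rel_ideal G E"
| mult_right: "x \<in> rel_ideal G E \<Longrightarrow> a \<in> free_alg G \<Longrightarrow> x * a \<in> rel_ideal G E"

definition pres_class ::
    "'g set \<Rightarrow> (('g fword \<Rightarrow>\<^sub>0 'r) \<times> ('g fword \<Rightarrow>\<^sub>0 'r)) set
      \<Rightarrow> ('g fword \<Rightarrow>\<^sub>0 'r) \<Rightarrow> ('g fword \<Rightarrow>\<^sub>0 'r::{comm_ring, comm_monoid_mult}) set" where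
  "pres_class G E x = {x + i |i. i \<in> rel_ideal G E}"

record ('r, 'a) nonunital_algebra = "'a partial_object" +
  alg_zero :: "'a"
  alg_add :: "'a \<Rightarrow> 'a \<Rightarrow> 'a"
  alg_mult :: "'a \<Rightarrow> 'a \<Rightarrow> 'a"
  alg_scale :: "'r \<Rightarrow> 'a \<Rightarrow> 'a"

definition presented_algebra ::
    "'g set \<Rightarrow> (('g fword \<Rightarrow>\<^sub>0 'r) \<times> ('g fword \<Rightarrow>\<^sub>0 'r)) set
      \<Rightarrow> ('r, ('g fword \<Rightarrow>\<^sub>0 'r::{comm_ring, comm_monoid_mult}) set) nonunital_algebra" where
  "presented_algebra G E =
     \<lparr>carrier = pres_class G E ` free_alg G,
      alg_zero = pres_class G E 0,
      alg_add = (\<lambda>X Y. \<Union>x\<in>X. \<Union>y\<in>Y. pres_class G E (x + y)),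
      alg_mult = (\<lambda>X Y. \<Union>x\<in>X. \<Union>y\<in>Y. pres_class G E (x * y)),
      alg_scale = (\<lambda>r X. \<Union>x\<in>X. pres_class G E (free_scale r x))\<rparr>"

definition algebra_iso ::
    "('r, 'a) nonunital_algebra \<Rightarrow> ('r, 'c) nonunital_algebra \<Rightarrow> ('a \<Rightarrow> 'c) \<Rightarrow> bool" where
  "algebra_iso S T f \<longleftrightarrow>
     bij_betw f (carrier S) (carrier T) \<and>
     f (alg_zero S) = alg_zero T \<and>
     (\<forall>x\<in>carrier S. \<forall>y\<in>carrier S.
        f (alg_add S x y) = alg_add T (f x) (f y) \<and>
        f (alg_mult S x y) = alg_mult T (f x) (f y)) \<and>
     (\<forall>r. \<forall>x\<in>carrier S. f (alg_scale S r x) = alg_scale T r (f x))"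


section \<open>The algebra of a relative generalized Boolean dynamical system\<close>

datatype ('l, 'b) gbds_gen = Proj 'b | Part 'l 'b | PartStar 'l 'b

type_synonym ('r, 'l, 'b) gbds_free = "('l, 'b) gbds_gen fword \<Rightarrow>\<^sub>0 'r"

definition gbds_gens :: "'b gba \<Rightarrow> 'l set \<Rightarrow> ('l \<Rightarrow> 'b set) \<Rightarrow> ('l, 'b) gbds_gen set" where
  "gbds_gens \<B> \<L> \<I> =
     {Proj A |A. A \<in> carrier \<B>} \<union>
     {Part \<alpha> B |\<alpha> B. \<alpha> \<in> \<L> \<and> B \<in> \<I> \<alpha>} \<union>
     {PartStar \<alpha> B |\<alpha> B. \<alpha> \<in> \<L> \<and> B \<in> \<I> \<alpha>}"

abbreviation pr :: "'b \<Rightarrow> ('r::{comm_ring, comm_monoid_mult}, 'l, 'b) gbds_free" where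
  "pr A \<equiv> free_var (Proj A)"

abbreviation ps :: "'l \<Rightarrow> 'b \<Rightarrow> ('r::{comm_ring, comm_monoid_mult}, 'l, 'b) gbds_free" where
  "ps \<alpha> B \<equiv> free_var (Part \<alpha> B)"

abbreviation ps_star :: "'l \<Rightarrow> 'b \<Rightarrow> ('r::{comm_ring, comm_monoid_mult}, 'l, 'b) gbds_free" where
  "ps_star \<alpha> B \<equiv> free_var (PartStar \<alpha> B)"

text \<open>
  In the rules \<open>ps_pr\<close> and \<open>pr_ps_star\<close> the set \<open>B'\<close> ranges over all of \<open>\<B>\<close> for which the
  right-hand side is a generator. If \<open>\<I> \<alpha>\<close> is an ideal this is no restriction; the family
  \<open>assoc_ideal\<close> below, however, need not be closed under meets with arbitrary elements.
\<close>

inductive_set gbds_rels ::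
    "'b gba \<Rightarrow> 'l set \<Rightarrow> ('l \<Rightarrow> 'b \<Rightarrow> 'b) \<Rightarrow> ('l \<Rightarrow> 'b set) \<Rightarrow> 'b set
      \<Rightarrow> (('r::{comm_ring, comm_monoid_mult}, 'l, 'b) gbds_free \<times> ('r, 'l, 'b) gbds_free) set"
  for \<B> (structure) and \<L> \<theta> \<I> \<J> where
  pr_zero: "(pr \<emptyset>, 0) \<in> gbds_rels \<B> \<L> \<theta> \<I> \<J>"
| pr_meet: "\<lbrakk>A \<in> carrier \<B>; A' \<in> carrier \<B>\<rbrakk>
    \<Longrightarrow> (pr (A \<sqinter> A'), pr A * pr A') \<in> gbds_rels \<B> \<L> \<theta> \<I> \<J>"
| pr_join: "\<lbrakk>A \<in> carrier \<B>; A' \<in> carrier \<B>\<rbrakk>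
    \<Longrightarrow> (pr (A \<squnion> A'), pr A + pr A' - pr (A \<sqinter> A')) \<in> gbds_rels \<B> \<L> \<theta> \<I> \<J>"
| pr_ps: "\<lbrakk>A \<in> carrier \<B>; \<alpha> \<in> \<L>; B \<in> \<I> \<alpha>\<rbrakk>
    \<Longrightarrow> (pr A * ps \<alpha> B, ps \<alpha> B * pr (\<theta> \<alpha> A)) \<in> gbds_rels \<B> \<L> \<theta> \<I> \<J>"
| ps_star_pr: "\<lbrakk>A \<in> carrier \<B>; \<alpha> \<in> \<L>; B \<in> \<I> \<alpha>\<rbrakk>
    \<Longrightarrow> (ps_star \<alpha> B * pr A, pr (\<theta> \<alpha> A) * ps_star \<alpha> B) \<in> gbds_rels \<B> \<L> \<theta> \<I> \<J>"
| ps_star_ps: "\<lbrakk>\<alpha> \<in> \<L>; B \<in> \<I> \<alpha>; \<alpha>' \<in> \<L>; B' \<in> \<I> \<alpha>'\<rbrakk>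
    \<Longrightarrow> (ps_star \<alpha> B * ps \<alpha>' B', if \<alpha> = \<alpha>' then pr (B \<sqinter> B') else 0) \<in> gbds_rels \<B> \<L> \<theta> \<I> \<J>"
| ps_pr: "\<lbrakk>\<alpha> \<in> \<L>; B \<in> \<I> \<alpha>; B' \<in> carrier \<B>; B \<sqinter> B' \<in> \<I> \<alpha>\<rbrakk>
    \<Longrightarrow> (ps \<alpha> B * pr B', ps \<alpha> (B \<sqinter> B')) \<in> gbds_rels \<B> \<L> \<theta> \<I> \<J>"
| pr_ps_star: "\<lbrakk>\<alpha> \<in> \<L>; B \<in> \<I> \<alpha>; B' \<in> carrier \<B>; B \<sqinter> B' \<in> \<I> \<alpha>\<rbrakk>
    \<Longrightarrow> (pr B' * ps_star \<alpha> B, ps_star \<alpha> (B \<sqinter> B')) \<in> gbds_rels \<B> \<L> \<theta> \<I> \<J>"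
| pr_sum: "A \<in> \<J>
    \<Longrightarrow> (pr A, \<Sum>\<alpha>\<in>gbds_Delta \<B> \<L> \<theta> A. ps \<alpha> (\<theta> \<alpha> A) * ps_star \<alpha> (\<theta> \<alpha> A))
        \<in> gbds_rels \<B> \<L> \<theta> \<I> \<J>"

definition gbds_alg ::
    "'b gba \<Rightarrow> 'l set \<Rightarrow> ('l \<Rightarrow> 'b \<Rightarrow> 'b) \<Rightarrow> ('l \<Rightarrow> 'b set) \<Rightarrow> 'b set
      \<Rightarrow> ('r, ('r::{comm_ring, comm_monoid_mult}, 'l, 'b) gbds_free set) nonunital_algebra" where
  "gbds_alg \<B> \<L> \<theta> \<I> \<J> =
     presented_algebra (gbds_gens \<B> \<L> \<I>) (gbds_rels \<B> \<L> \<theta> \<I> \<J>)"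

definition gbds_class ::
    "'b gba \<Rightarrow> 'l set \<Rightarrow> ('l \<Rightarrow> 'b \<Rightarrow> 'b) \<Rightarrow> ('l \<Rightarrow> 'b set) \<Rightarrow> 'b set
      \<Rightarrow> ('r::{comm_ring, comm_monoid_mult}, 'l, 'b) gbds_free \<Rightarrow> ('r, 'l, 'b) gbds_free set" where
  "gbds_class \<B> \<L> \<theta> \<I> \<J> =
     pres_class (gbds_gens \<B> \<L> \<I>) (gbds_rels \<B> \<L> \<theta> \<I> \<J>)"

text \<open>Only meaningful when \<open>gbds_Delta \<B> \<L> \<theta> A\<close> is finite, e.g. for \<open>A \<in> gbds_reg \<B> \<L> \<theta>\<close>.\<close>

definition gap_proj ::
    "'b gba \<Rightarrow> 'l set \<Rightarrow> ('l \<Rightarrow> 'b \<Rightarrow> 'b) \<Rightarrow> 'b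
      \<Rightarrow> ('r::{comm_ring, comm_monoid_mult}, 'l, 'b) gbds_free" where
  "gap_proj \<B> \<L> \<theta> A =
     pr A - (\<Sum>\<alpha>\<in>gbds_Delta \<B> \<L> \<theta> A. ps \<alpha> (\<theta> \<alpha> A) * ps_star \<alpha> (\<theta> \<alpha> A))"


section \<open>The associated system\<close>

definition assoc_gba ::
    "'b gba \<Rightarrow> 'l set \<Rightarrow> ('l \<Rightarrow> 'b \<Rightarrow> 'b) \<Rightarrow> 'b set \<Rightarrow> ('b \<times> 'b set) gba" where
  "assoc_gba \<B> \<L> \<theta> \<J> =
     (let Q = gba_quotient \<B> \<J> in
     \<lparr>carrier = {(A, gba_class \<B> \<J> B) |A B. A \<in> carrier \<B> \<and> B \<in> carrier \<B> \<and>
        gba_class \<B> (gbds_reg \<B> \<L> \<theta>) A = gba_class \<B> (gbds_reg \<B> \<L> \<theta>) B},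
      bjoin = (\<lambda>(A, X) (A', X'). (A \<squnion>\<^bsub>\<B>\<^esub> A', X \<squnion>\<^bsub>Q\<^esub> X')),
      bmeet = (\<lambda>(A, X) (A', X'). (A \<sqinter>\<^bsub>\<B>\<^esub> A', X \<sqinter>\<^bsub>Q\<^esub> X')),
      bdiff = (\<lambda>(A, X) (A', X'). (A \<setminus>\<^bsub>\<B>\<^esub> A', X \<setminus>\<^bsub>Q\<^esub> X')),
      bzero = (\<emptyset>\<^bsub>\<B>\<^esub>, \<emptyset>\<^bsub>Q\<^esub>)\<rparr>)"

definition assoc_theta ::
    "'b gba \<Rightarrow> 'b set \<Rightarrow> ('l \<Rightarrow> 'b \<Rightarrow> 'b) \<Rightarrow> 'l \<Rightarrow> 'b \<times> 'b set \<Rightarrow> 'b \<times> 'b set" where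
  "assoc_theta \<B> \<J> \<theta> \<alpha> = (\<lambda>(A, X). (\<theta> \<alpha> A, gba_class \<B> \<J> (\<theta> \<alpha> A)))"

definition assoc_ideal ::
    "'b gba \<Rightarrow> 'b set \<Rightarrow> ('l \<Rightarrow> 'b set) \<Rightarrow> 'l \<Rightarrow> ('b \<times> 'b set) set" where
  "assoc_ideal \<B> \<J> \<I> \<alpha> = {(A, gba_class \<B> \<J> A) |A. A \<in> \<I> \<alpha>}"

end

theory Submission
  imports Defs
begin

text \<open>
  Both algebras are given by generators and relations, so each homomorphism is obtained from a choice
  of values on generators that satisfies the relations (locale \<open>presentation_hom\<close>), and the two are
  mutually inverse as soon as their composites fix the generators (\<open>pres_hom_left_inverse\<close>).
  Equality in a presented algebra is treated as the congruence \<open>rcong\<close> on the free algebra.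
  
  For \<open>\<phi>\<close> every relation becomes an instance of a relation of the associated system. For the sum
  relation, \<open>A \<in> \<J>\<close> gives \<open>(A, [A]) = (A, \<emptyset>)\<close>, and the pairs \<open>(A, \<emptyset>)\<close> with \<open>A\<close> regular are
  precisely the regular elements of that system (\<open>treg_iff\<close>).
  
  For \<open>\<psi>\<close> the point is that, for regular \<open>W\<close>, the gap projection \<open>q\<^sub>W\<close> is an idempotent which
  commutes with all projections, annihilates all partial isometries from the left and their adjoints
  from the right (\<open>pr_q\<close>, \<open>q_pr\<close>, \<open>q_idem\<close>, \<open>q_ps\<close>, \<open>ps_star_q\<close>), and vanishes when \<open>W \<in> \<J>\<close>
  (\<open>q_J\<close>). If \<open>A \<union> W = B \<union> W\<close>, then, for \<open>C\<close> and \<open>D\<close> as in the definition of \<open>\<psi>\<close>,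
  \<open>p\<^sub>A + q\<^sub>C - q\<^sub>D = p\<^sub>A + q\<^sub>W (p\<^sub>B - p\<^sub>A)\<close>: the pair \<open>(A, [B])\<close> is sent to the element that
  is \<open>p\<^sub>B\<close> under \<open>q\<^sub>W\<close> and \<open>p\<^sub>A\<close> away from it (\<open>patch\<close>). It does not depend on the choices
  (\<open>patch_cong\<close>), and multiplicativity and the rule for joins hold because they hold on both parts
  (\<open>patch_meet\<close>, \<open>patch_join\<close>).
  
  On generators, \<open>\<psi>\<close> after \<open>\<phi>\<close> is the identity since the correction term vanishes for \<open>A = B\<close>.
  In the other direction, \<open>\<phi>\<close> sends \<open>q\<^sub>W\<close> to the projection of \<open>(\<emptyset>, [W])\<close> (\<open>phi_q\<close>), and
  \<open>p\<^sub>A + q\<^sub>W (p\<^sub>B - p\<^sub>A)\<close> becomes the projection of \<open>(A, [B])\<close> (\<open>phi_patch\<close>).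
\<close>

section \<open>The free algebra and its universal property\<close>

lemma free_scale_conv_mult: "free_scale r x = Poly_Mapping.single 0 r * x"
  unfolding free_scale_def by (rule mult_map_scale_conv_mult)

lemma single_zero_commute:
  fixes x :: "'g fword \<Rightarrow>\<^sub>0 'r::{comm_ring, comm_monoid_mult}"
  shows "x * Poly_Mapping.single 0 r = Poly_Mapping.single 0 r * x"
proof (induction x rule: update_induct)
  case (update f a b)
  have "Poly_Mapping.update a b f = f + Poly_Mapping.single a b"
    using update.hyps
    by (intro poly_mapping_eqI) (auto simp: lookup_update lookup_add lookup_single in_keys_iff when_def)
  then show ?case
    by (simp add: distrib_left distrib_right update.IH mult_single mult.commute)
qed simp

lemma free_scale_diff: "free_scale r (x - y) = free_scale r x - free_scale r y"
  by (simp add: free_scale_conv_mult right_diff_distrib)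

lemma free_scale_mult_left: "free_scale r x * y = free_scale r (x * y)"
  by (simp add: free_scale_conv_mult mult.assoc)

lemma free_scale_mult_right: "x * free_scale r y = free_scale r (x * y)"
  by (simp only: free_scale_conv_mult mult.assoc[symmetric] single_zero_commute[of x r])

text \<open>
  The coefficient ring may be trivial, so the type of free algebras carries no \<open>1\<close> of its own;
  \<open>Poly_Mapping.single 0 1\<close>, the empty word with coefficient \<open>1\<close>, is its unit.
\<close>

lemma single_zero_one_mult [simp]:
  fixes x :: "'g fword \<Rightarrow>\<^sub>0 'r::{comm_ring, comm_monoid_mult}"
  shows "Poly_Mapping.single 0 1 * x = x" "x * Poly_Mapping.single 0 1 = x"
proof -
  have times_one_eq: "(*) (1 :: 'r) = (\<lambda>a. a)"
    by (simp add: fun_eq_iff)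
  have "Poly_Mapping.single 0 1 * x = Poly_Mapping.map (\<lambda>a. a) x"
    using mult_map_scale_conv_mult[of 1 x, symmetric] by (simp add: times_one_eq)
  also have "\<dots> = x"
    by (rule poly_mapping_eqI, transfer) (simp add: when_def)
  finally show "Poly_Mapping.single 0 1 * x = x" .
  then show "x * Poly_Mapping.single 0 1 = x"
    by (simp add: single_zero_commute)
qed

lemma sum_monomials:
  "(\<Sum>w\<in>Poly_Mapping.keys x. Poly_Mapping.single w (Poly_Mapping.lookup x w)) = x"
  by (rule poly_mapping_eqI)
     (simp add: lookup_sum lookup_single when_def in_keys_iff)

lemma free_alg_zero [simp]: "0 \<in> free_alg G"
  by (simp add: free_alg_def)

lemma free_alg_add [simp]: "x \<in> free_alg G \<Longrightarrow> y \<in> free_alg G \<Longrightarrow> x + y \<in> free_alg G"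
  using keys_add[of x y] unfolding free_alg_def by blast

lemma free_alg_uminus [simp]: "x \<in> free_alg G \<Longrightarrow> - x \<in> free_alg G"
  by (simp add: free_alg_def in_keys_iff)

lemma free_alg_diff [simp]: "x \<in> free_alg G \<Longrightarrow> y \<in> free_alg G \<Longrightarrow> x - y \<in> free_alg G"
  using free_alg_add[of x G "- y"] by simp

lemma free_alg_sum [simp]: "(\<And>i. i \<in> S \<Longrightarrow> f i \<in> free_alg G) \<Longrightarrow> sum f S \<in> free_alg G"
  by (induction S rule: infinite_finite_induct) auto

lemma free_alg_mult [simp]:
  assumes "x \<in> free_alg G" "y \<in> free_alg G"
  shows "x * y \<in> free_alg G"
  unfolding free_alg_def
proof (intro CollectI ballI)
  fix w assume "w \<in> Poly_Mapping.keys (x * y)"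
  then obtain u v where "w = u + v" "u \<in> Poly_Mapping.keys x" "v \<in> Poly_Mapping.keys y"
    using keys_mult[of x y] by blast
  with assms show "letters w \<noteq> [] \<and> set (letters w) \<subseteq> G"
    by (auto simp: free_alg_def plus_fword_def)
qed

lemma free_alg_scale [simp]: "x \<in> free_alg G \<Longrightarrow> free_scale r x \<in> free_alg G"
  unfolding free_alg_def free_scale_def
  by (auto simp: in_keys_iff Poly_Mapping.map.rep_eq when_def split: if_splits)

lemma free_alg_var [simp]: "g \<in> G \<Longrightarrow> free_var g \<in> free_alg G"
  by (auto simp: free_alg_def free_var_def)

lemma free_alg_induct [consumes 1, case_names zero add var mult scale]:
  fixes x :: "'g fword \<Rightarrow>\<^sub>0 'r::{comm_ring, comm_monoid_mult}"
  assumes x: "x \<in> free_alg G"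
    and zero: "P 0"
    and add: "\<And>x y. x \<in> free_alg G \<Longrightarrow> P x \<Longrightarrow> y \<in> free_alg G \<Longrightarrow> P y \<Longrightarrow> P (x + y)"
    and var: "\<And>g. g \<in> G \<Longrightarrow> P (free_var g)"
    and mult: "\<And>x y. x \<in> free_alg G \<Longrightarrow> P x \<Longrightarrow> y \<in> free_alg G \<Longrightarrow> P y \<Longrightarrow> P (x * y)"
    and scale: "\<And>r x. x \<in> free_alg G \<Longrightarrow> P x \<Longrightarrow> P (free_scale r x)"
  shows "P x"
proof -
  have word: "Poly_Mapping.single (FWord l) (1 :: 'r) \<in> free_alg G \<and> P (Poly_Mapping.single (FWord l) 1)"
    if "l \<noteq> []" "set l \<subseteq> G" for l
    using that
  proof (induction l rule: list_nonempty_induct)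
    case (single g)
    then show ?case
      using var[of g] free_alg_var[of g G] by (simp add: free_var_def)
  next
    case (cons g l)
    have "Poly_Mapping.single (FWord (g # l)) (1 :: 'r) = free_var g * Poly_Mapping.single (FWord l) 1"
      by (simp add: free_var_def mult_single plus_fword_def)
    with cons show ?case
      using var[of g] mult[of "free_var g"] by simp
  qed
  have mono: "Poly_Mapping.single w r \<in> free_alg G \<and> P (Poly_Mapping.single w r)"
    if "letters w \<noteq> []" "set (letters w) \<subseteq> G" for w r
  proof -
    have "Poly_Mapping.single w r = free_scale r (Poly_Mapping.single (FWord (letters w)) 1)"
      by (simp add: free_scale_conv_mult mult_single)
    then show ?thesis
      using word[OF that] scale by simp
  qed
  have "(\<Sum>w\<in>K. Poly_Mapping.single w (Poly_Mapping.lookup x w)) \<in> free_alg G \<and>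
        P (\<Sum>w\<in>K. Poly_Mapping.single w (Poly_Mapping.lookup x w))"
    if "finite K" "K \<subseteq> Poly_Mapping.keys x" for K
    using that
  proof (induction K rule: finite_induct)
    case (insert w K)
    then have "letters w \<noteq> []" "set (letters w) \<subseteq> G"
      using x by (auto simp: free_alg_def)
    then show ?case
      using insert mono add by simp
  qed (simp add: zero)
  from this[of "Poly_Mapping.keys x"] show ?thesis
    by (simp add: sum_monomials)
qed

text \<open>
  The value of a word under a substitution \<open>F\<close> of elements of a free algebra for the letters.
\<close>

primrec word_eval :: "('g \<Rightarrow> 'h fword \<Rightarrow>\<^sub>0 'r) \<Rightarrow> 'g list \<Rightarrow> 'h fword \<Rightarrow>\<^sub>0 'r::{comm_ring, comm_monoid_mult}"
  where
    "word_eval F [] = Poly_Mapping.single 0 1"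
  | "word_eval F (g # l) = F g * word_eval F l"

lemma word_eval_append: "word_eval F (l @ m) = word_eval F l * word_eval F m"
  by (induction l) (simp_all add: mult.assoc)

text \<open>
  The algebra homomorphism between free algebras that extends an assignment \<open>F\<close> of the generators.
\<close>

definition subst_hom ::
    "('g \<Rightarrow> 'h fword \<Rightarrow>\<^sub>0 'r) \<Rightarrow> ('g fword \<Rightarrow>\<^sub>0 'r) \<Rightarrow> 'h fword \<Rightarrow>\<^sub>0 'r::{comm_ring, comm_monoid_mult}"
  where "subst_hom F x =
    (\<Sum>w\<in>Poly_Mapping.keys x. free_scale (Poly_Mapping.lookup x w) (word_eval F (letters w)))"

lemma subst_hom_superset:
  assumes "finite K" "Poly_Mapping.keys x \<subseteq> K"
  shows "subst_hom F x =
    (\<Sum>w\<in>K. free_scale (Poly_Mapping.lookup x w) (word_eval F (letters w)))"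
  unfolding subst_hom_def using assms
  by (intro sum.mono_neutral_left) (auto simp: in_keys_iff free_scale_conv_mult)

lemma subst_hom_zero [simp]: "subst_hom F 0 = 0"
  by (simp add: subst_hom_def)

lemma subst_hom_add [simp]: "subst_hom F (x + y) = subst_hom F x + subst_hom F y"
proof -
  let ?K = "Poly_Mapping.keys x \<union> Poly_Mapping.keys y"
  show ?thesis
    using keys_add[of x y]
    by (simp add: subst_hom_superset[of ?K] lookup_add free_scale_conv_mult single_add
        distrib_right sum.distrib)
qed

lemma subst_hom_uminus [simp]: "subst_hom F (- x) = - subst_hom F x"
  using subst_hom_add[of F x "- x"] by (simp add: eq_neg_iff_add_eq_0 add.commute)

lemma subst_hom_diff [simp]: "subst_hom F (x - y) = subst_hom F x - subst_hom F y"
  using subst_hom_add[of F x "- y"] by simp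

lemma subst_hom_sum [simp]: "subst_hom F (sum f S) = (\<Sum>i\<in>S. subst_hom F (f i))"
  by (induction S rule: infinite_finite_induct) auto

lemma subst_hom_single:
  "subst_hom F (Poly_Mapping.single w r) = free_scale r (word_eval F (letters w))"
  by (subst subst_hom_superset[of "{w}"]) auto

lemma subst_hom_var [simp]: "subst_hom F (free_var g) = F g"
  by (simp add: free_var_def subst_hom_single free_scale_conv_mult)

lemma subst_hom_mult [simp]: "subst_hom F (x * y) = subst_hom F x * subst_hom F y"
proof -
  have *: "subst_hom F (Poly_Mapping.single v r * Poly_Mapping.single w s)
      = subst_hom F (Poly_Mapping.single v r) * subst_hom F (Poly_Mapping.single w s)" for v w r s
    by (simp add: mult_single subst_hom_single plus_fword_def word_eval_append
        free_scale_mult_left free_scale_mult_right)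
       (simp add: free_scale_conv_mult mult_single mult.assoc[symmetric] mult.commute[of s r])
  let ?m = "\<lambda>x w. Poly_Mapping.single w (Poly_Mapping.lookup x w)"
  have "subst_hom F ((\<Sum>v\<in>Poly_Mapping.keys x. ?m x v) * (\<Sum>w\<in>Poly_Mapping.keys y. ?m y w))
      = subst_hom F (\<Sum>v\<in>Poly_Mapping.keys x. ?m x v) * subst_hom F (\<Sum>w\<in>Poly_Mapping.keys y. ?m y w)"
    by (simp add: sum_product *)
  then show ?thesis
    by (simp only: sum_monomials)
qed

lemma subst_hom_scale [simp]: "subst_hom F (free_scale r x) = free_scale r (subst_hom F x)"
proof -
  have "subst_hom F (free_scale r x) = subst_hom F (Poly_Mapping.single 0 r) * subst_hom F x"
    by (simp add: free_scale_conv_mult)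
  also have "subst_hom F (Poly_Mapping.single 0 r) = Poly_Mapping.single 0 r"
    by (simp add: subst_hom_single free_scale_conv_mult zero_fword_def mult_single plus_fword_def)
  finally show ?thesis
    by (simp add: free_scale_conv_mult)
qed

lemma subst_hom_closed:
  assumes F: "\<And>g. g \<in> G \<Longrightarrow> F g \<in> free_alg H" and x: "x \<in> free_alg G"
  shows "subst_hom F x \<in> free_alg H"
  using x by (induction rule: free_alg_induct) (simp_all add: F)


section \<open>Congruence modulo the relations\<close>

text \<open>
  Equality in the algebra presented by \<open>G\<close> and \<open>E\<close>, expressed on representatives in the free algebra.
  The ideal absorbs multiplication by elements of \<^term>\<open>free_alg G\<close>, which is why the
  rules for products have membership conditions.
\<close>

definition rcong ::
    "'g set \<Rightarrow> (('g fword \<Rightarrow>\<^sub>0 'r) \<times> ('g fword \<Rightarrow>\<^sub>0 'r)) set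
      \<Rightarrow> ('g fword \<Rightarrow>\<^sub>0 'r) \<Rightarrow> ('g fword \<Rightarrow>\<^sub>0 'r::{comm_ring, comm_monoid_mult}) \<Rightarrow> bool" where
  "rcong G E x y \<longleftrightarrow> x - y \<in> rel_ideal G E"

lemma rel_ideal_uminus: "x \<in> rel_ideal G E \<Longrightarrow> - x \<in> rel_ideal G E"
proof -
  assume "x \<in> rel_ideal G E"
  then have "free_scale (- 1) x \<in> rel_ideal G E"
    by (rule rel_ideal.scale)
  moreover have "free_scale (- 1) x = - x"
    by (simp add: free_scale_conv_mult single_uminus)
  ultimately show ?thesis by simp
qed

lemma rel_ideal_diff: "x \<in> rel_ideal G E \<Longrightarrow> y \<in> rel_ideal G E \<Longrightarrow> x - y \<in> rel_ideal G E"
  using rel_ideal.add[of x G E "- y"] rel_ideal_uminus[of y] by simp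

lemma rel_ideal_subset:
  assumes E: "\<And>u v. (u, v) \<in> E \<Longrightarrow> u \<in> free_alg G \<and> v \<in> free_alg G"
    and x: "x \<in> rel_ideal G E"
  shows "x \<in> free_alg G"
  using x by induction (use E in auto)

lemma rcong_refl [simp]: "rcong G E x x"
  by (simp add: rcong_def rel_ideal.zero)

lemma rcong_sym [sym]: "rcong G E x y \<Longrightarrow> rcong G E y x"
  using rel_ideal_uminus[of "x - y" G E] by (simp add: rcong_def)

lemma rcong_trans [trans]: "rcong G E x y \<Longrightarrow> rcong G E y z \<Longrightarrow> rcong G E x z"
  using rel_ideal.add[of "x - y" G E "y - z"] by (simp add: rcong_def)

lemma rcong_eq_trans [trans]:
  "rcong G E x y \<Longrightarrow> y = z \<Longrightarrow> rcong G E x z"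
  "x = y \<Longrightarrow> rcong G E y z \<Longrightarrow> rcong G E x z"
  by simp_all

lemma rcong_rel: "(u, v) \<in> E \<Longrightarrow> rcong G E u v"
  by (simp add: rcong_def rel_ideal.rel)

lemma rcong_add: "rcong G E x x' \<Longrightarrow> rcong G E y y' \<Longrightarrow> rcong G E (x + y) (x' + y')"
  using rel_ideal.add[of "x - x'" G E "y - y'"] by (simp add: rcong_def algebra_simps)

lemma rcong_diff: "rcong G E x x' \<Longrightarrow> rcong G E y y' \<Longrightarrow> rcong G E (x - y) (x' - y')"
  using rel_ideal_diff[of "x - x'" G E "y - y'"] by (simp add: rcong_def algebra_simps)

lemma rcong_sum: "(\<And>i. i \<in> S \<Longrightarrow> rcong G E (f i) (g i)) \<Longrightarrow> rcong G E (sum f S) (sum g S)"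
  by (induction S rule: infinite_finite_induct) (auto intro: rcong_add)

lemma rcong_sum_superset:
  assumes "finite T" "S \<subseteq> T" "\<And>i. i \<in> T - S \<Longrightarrow> rcong G E (f i) 0"
  shows "rcong G E (sum f T) (sum f S)"
proof -
  have "rcong G E (sum f (T - S)) (\<Sum>i\<in>T - S. 0)"
    using assms by (intro rcong_sum) auto
  then have "rcong G E (sum f (T - S) + sum f S) (0 + sum f S)"
    by (intro rcong_add) auto
  then show ?thesis
    using assms by (simp add: sum.subset_diff[of S T])
qed

lemma rcong_scale: "rcong G E x y \<Longrightarrow> rcong G E (free_scale r x) (free_scale r y)"
  using rel_ideal.scale[of "x - y" G E r] by (simp add: rcong_def free_scale_diff)

lemma rcong_mult_left: "a \<in> free_alg G \<Longrightarrow> rcong G E x y \<Longrightarrow> rcong G E (a * x) (a * y)"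
  using rel_ideal.mult_left[of "x - y" G E a] by (simp add: rcong_def right_diff_distrib)

lemma rcong_mult_right: "a \<in> free_alg G \<Longrightarrow> rcong G E x y \<Longrightarrow> rcong G E (x * a) (y * a)"
  using rel_ideal.mult_right[of "x - y" G E a] by (simp add: rcong_def left_diff_distrib)

lemma rcong_mult:
  "a \<in> free_alg G \<Longrightarrow> b' \<in> free_alg G \<Longrightarrow> rcong G E a a' \<Longrightarrow> rcong G E b b'
    \<Longrightarrow> rcong G E (a * b) (a' * b')"
  by (meson rcong_mult_left rcong_mult_right rcong_trans)

lemma mem_pres_class: "y \<in> pres_class G E x \<longleftrightarrow> rcong G E y x"
  unfolding pres_class_def rcong_def by (auto simp: algebra_simps) (metis add.commute diff_add_cancel)

lemma pres_class_eq_iff: "pres_class G E x = pres_class G E y \<longleftrightarrow> rcong G E x y"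
proof
  assume "pres_class G E x = pres_class G E y"
  then have "x \<in> pres_class G E y"
    using mem_pres_class[of x G E x] by simp
  then show "rcong G E x y"
    by (simp add: mem_pres_class)
next
  assume "rcong G E x y"
  then show "pres_class G E x = pres_class G E y"
    by (simp only: set_eq_iff mem_pres_class) (meson rcong_sym rcong_trans)
qed

lemma UN_pres_class_eqI:
  assumes "\<And>y. rcong G E y x \<Longrightarrow> f y = c"
  shows "(\<Union>y\<in>pres_class G E x. f y) = c"
proof -
  have "x \<in> pres_class G E x"
    by (simp add: mem_pres_class)
  then show ?thesis
    using assms by (auto simp only: mem_pres_class)
qed


section \<open>Homomorphisms between presented algebras\<close>

text \<open>
  A presentation whose relations only involve words in its own generators. This is what makes the
  multiplication of classes independent of the representatives.
\<close>

locale presentation =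
  fixes G :: "'g set"
    and E :: "(('g fword \<Rightarrow>\<^sub>0 'r::{comm_ring, comm_monoid_mult}) \<times> ('g fword \<Rightarrow>\<^sub>0 'r)) set"
  assumes rels_closed: "(u, v) \<in> E \<Longrightarrow> u \<in> free_alg G \<and> v \<in> free_alg G"
begin

lemma carrier_presented: "carrier (presented_algebra G E) = pres_class G E ` free_alg G"
  by (simp add: presented_algebra_def)

lemma zero_presented: "alg_zero (presented_algebra G E) = pres_class G E 0"
  by (simp add: presented_algebra_def)

lemma add_presented:
  "alg_add (presented_algebra G E) (pres_class G E x) (pres_class G E y) = pres_class G E (x + y)"
  unfolding presented_algebra_def nonunital_algebra.simps
  by (intro UN_pres_class_eqI) (simp add: pres_class_eq_iff rcong_add)

lemma mult_presented:
  assumes "x \<in> free_alg G" "y \<in> free_alg G"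
  shows "alg_mult (presented_algebra G E) (pres_class G E x) (pres_class G E y)
    = pres_class G E (x * y)"
  unfolding presented_algebra_def nonunital_algebra.simps
proof (intro UN_pres_class_eqI)
  fix x' y' assume *: "rcong G E x' x" "rcong G E y' y"
  then have "x' - x \<in> free_alg G"
    using rel_ideal_subset[of E G] rels_closed by (auto simp: rcong_def)
  then have "x' \<in> free_alg G"
    using free_alg_add[of "x' - x" G x] assms(1) by simp
  with * assms show "pres_class G E (x' * y') = pres_class G E (x * y)"
    by (simp add: pres_class_eq_iff rcong_mult)
qed

lemma scale_presented:
  "alg_scale (presented_algebra G E) r (pres_class G E x) = pres_class G E (free_scale r x)"
  unfolding presented_algebra_def nonunital_algebra.simps
  by (intro UN_pres_class_eqI) (simp add: pres_class_eq_iff rcong_scale)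

end

text \<open>
  The map between presented algebras induced by an assignment \<open>F\<close> of the generators. The union is
  over sets that are all equal when \<open>X\<close> is a class and \<open>F\<close> respects the relations.
\<close>

definition pres_hom ::
    "'h set \<Rightarrow> (('h fword \<Rightarrow>\<^sub>0 'r) \<times> ('h fword \<Rightarrow>\<^sub>0 'r)) set \<Rightarrow> ('g \<Rightarrow> 'h fword \<Rightarrow>\<^sub>0 'r)
      \<Rightarrow> ('g fword \<Rightarrow>\<^sub>0 'r) set \<Rightarrow> ('h fword \<Rightarrow>\<^sub>0 'r::{comm_ring, comm_monoid_mult}) set" where
  "pres_hom H D F X = (\<Union>x\<in>X. pres_class H D (subst_hom F x))"

text \<open>
  An assignment of the generators of one presentation to elements of another one that satisfies
  the defining relations. By the universal property it induces a homomorphism.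
\<close>

locale presentation_hom = src: presentation G E + tgt: presentation H D
  for G :: "'g set"
    and E :: "(('g fword \<Rightarrow>\<^sub>0 'r::{comm_ring, comm_monoid_mult}) \<times> ('g fword \<Rightarrow>\<^sub>0 'r)) set"
    and H :: "'h set"
    and D :: "(('h fword \<Rightarrow>\<^sub>0 'r) \<times> ('h fword \<Rightarrow>\<^sub>0 'r)) set" +
  fixes F :: "'g \<Rightarrow> 'h fword \<Rightarrow>\<^sub>0 'r"
  assumes gens_closed: "g \<in> G \<Longrightarrow> F g \<in> free_alg H"
    and rels_hold: "(u, v) \<in> E \<Longrightarrow> rcong H D (subst_hom F u) (subst_hom F v)"
begin

lemma subst_hom_rel_ideal: "x \<in> rel_ideal G E \<Longrightarrow> subst_hom F x \<in> rel_ideal H D"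
proof (induction rule: rel_ideal.induct)
  case (rel u v)
  then show ?case
    using rels_hold by (simp add: rcong_def)
qed (simp_all add: rel_ideal.intros subst_hom_closed[of G F H] gens_closed)

lemma subst_hom_rcong: "rcong G E x y \<Longrightarrow> rcong H D (subst_hom F x) (subst_hom F y)"
  using subst_hom_rel_ideal[of "x - y"] by (simp add: rcong_def)

lemma pres_hom_class: "pres_hom H D F (pres_class G E x) = pres_class H D (subst_hom F x)"
  unfolding pres_hom_def
  by (intro UN_pres_class_eqI) (simp add: pres_class_eq_iff subst_hom_rcong)

lemma pres_hom_iso:
  assumes "bij_betw (pres_hom H D F) (carrier (presented_algebra G E)) (carrier (presented_algebra H D))"
  shows "algebra_iso (presented_algebra G E) (presented_algebra H D) (pres_hom H D F)"
  unfolding algebra_iso_def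
  using assms
  by (auto simp: src.carrier_presented src.zero_presented src.add_presented src.mult_presented
      src.scale_presented tgt.zero_presented tgt.add_presented tgt.mult_presented
      tgt.scale_presented pres_hom_class subst_hom_closed[of G F H] gens_closed)

lemma pres_hom_closed:
  "X \<in> carrier (presented_algebra G E) \<Longrightarrow> pres_hom H D F X \<in> carrier (presented_algebra H D)"
  by (auto simp: src.carrier_presented tgt.carrier_presented pres_hom_class
      subst_hom_closed[of G F H] gens_closed)

end

text \<open>
  Since a homomorphism is determined by its values on generators, it suffices to check on
  generators that one homomorphism is a left inverse of another.
\<close>

lemma pres_hom_left_inverse:
  assumes "presentation_hom G E H D F" "presentation_hom H D G E F'"
    and gen: "\<And>g. g \<in> G \<Longrightarrow> rcong G E (subst_hom F' (F g)) (free_var g)"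
    and X: "X \<in> carrier (presented_algebra G E)"
  shows "pres_hom G E F' (pres_hom H D F X) = X"
proof -
  interpret F: presentation_hom G E H D F by fact
  interpret F': presentation_hom H D G E F' by fact
  have "rcong G E (subst_hom F' (subst_hom F x)) x" if "x \<in> free_alg G" for x
    using that
    by (induction rule: free_alg_induct)
       (simp_all add: gen rcong_add rcong_scale rcong_mult subst_hom_closed[of H F' G]
         subst_hom_closed[of G F H] F.gens_closed F'.gens_closed)
  moreover obtain x where "x \<in> free_alg G" "X = pres_class G E x"
    using X by (auto simp: F.src.carrier_presented)
  ultimately show ?thesis
    by (simp add: F.pres_hom_class F'.pres_hom_class pres_class_eq_iff)
qed

section \<open>Generalized Boolean algebras and quotients\<close>

context generalized_boolean_algebra
begin

lemmas closed [simp] = join_closed meet_closed diff_closed zero_closed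

lemma join_left_comm:
  "\<lbrakk>A \<in> carrier \<B>; C \<in> carrier \<B>; D \<in> carrier \<B>\<rbrakk> \<Longrightarrow> A \<squnion> (C \<squnion> D) = C \<squnion> (A \<squnion> D)"
  by (metis join_assoc join_comm)

lemma meet_left_comm:
  "\<lbrakk>A \<in> carrier \<B>; C \<in> carrier \<B>; D \<in> carrier \<B>\<rbrakk> \<Longrightarrow> A \<sqinter> (C \<sqinter> D) = C \<sqinter> (A \<sqinter> D)"
  by (metis meet_assoc meet_comm)

lemmas join_ac = join_assoc join_comm join_left_comm
lemmas meet_ac = meet_assoc meet_comm meet_left_comm

lemma join_idem [simp]: "A \<in> carrier \<B> \<Longrightarrow> A \<squnion> A = A"
  by (metis join_absorb join_closed meet_absorb)

lemma meet_idem [simp]: "A \<in> carrier \<B> \<Longrightarrow> A \<sqinter> A = A"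
  by (metis join_absorb meet_closed meet_absorb)

lemma meet_left_idem [simp]: "A \<in> carrier \<B> \<Longrightarrow> C \<in> carrier \<B> \<Longrightarrow> A \<sqinter> (A \<sqinter> C) = A \<sqinter> C"
  by (metis meet_assoc meet_idem)

lemma zero_meet [simp]: "A \<in> carrier \<B> \<Longrightarrow> \<emptyset> \<sqinter> A = \<emptyset>" "A \<in> carrier \<B> \<Longrightarrow> A \<sqinter> \<emptyset> = \<emptyset>"
  using zero_least meet_comm by (auto simp: bleq_def)

lemma zero_join [simp]: "A \<in> carrier \<B> \<Longrightarrow> \<emptyset> \<squnion> A = A" "A \<in> carrier \<B> \<Longrightarrow> A \<squnion> \<emptyset> = A"
  by (metis join_absorb join_comm zero_closed zero_meet(2))+

lemma join_meet_distrib: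
  assumes "A \<in> carrier \<B>" "C \<in> carrier \<B>" "D \<in> carrier \<B>"
  shows "A \<squnion> (C \<sqinter> D) = (A \<squnion> C) \<sqinter> (A \<squnion> D)"
proof -
  have "(A \<squnion> C) \<sqinter> (A \<squnion> D) = ((A \<squnion> C) \<sqinter> A) \<squnion> ((A \<squnion> C) \<sqinter> D)"
    using assms by (simp add: meet_join_distrib)
  also have "\<dots> = A \<squnion> (D \<sqinter> (A \<squnion> C))"
    using assms meet_absorb[of A C] meet_comm[of "A \<squnion> C"] by simp
  also have "\<dots> = (A \<squnion> (A \<sqinter> D)) \<squnion> (C \<sqinter> D)"
    using assms by (simp add: meet_join_distrib join_assoc meet_comm)
  finally show ?thesis
    using assms by (simp add: join_absorb)
qed

lemma join_meet_distrib2: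
  "\<lbrakk>A \<in> carrier \<B>; C \<in> carrier \<B>; D \<in> carrier \<B>\<rbrakk> \<Longrightarrow> (C \<sqinter> D) \<squnion> A = (C \<squnion> A) \<sqinter> (D \<squnion> A)"
  by (metis meet_closed join_comm join_meet_distrib)

lemma join_eq_zero_iff:
  assumes "A \<in> carrier \<B>" "C \<in> carrier \<B>"
  shows "A \<squnion> C = \<emptyset> \<longleftrightarrow> A = \<emptyset> \<and> C = \<emptyset>"
  using assms by (metis join_comm meet_absorb zero_join(1) zero_meet(2) zero_closed)

lemma ideal_carrier: "gba_ideal \<B> K \<Longrightarrow> A \<in> K \<Longrightarrow> A \<in> carrier \<B>"
  by (auto simp: gba_ideal_def)

lemma ideal_join: "gba_ideal \<B> K \<Longrightarrow> A \<in> K \<Longrightarrow> C \<in> K \<Longrightarrow> A \<squnion> C \<in> K"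
  by (auto simp: gba_ideal_def)

lemma ideal_meet: "gba_ideal \<B> K \<Longrightarrow> A \<in> K \<Longrightarrow> C \<in> carrier \<B> \<Longrightarrow> A \<sqinter> C \<in> K"
  by (auto simp: gba_ideal_def)

lemma ideal_zero: "gba_ideal \<B> K \<Longrightarrow> \<emptyset> \<in> K"
  unfolding gba_ideal_def by (metis equals0I subsetD zero_closed zero_meet(2))

text \<open>
  Witnesses of congruence modulo an ideal may be enlarged.
\<close>

lemma join_eq_mono:
  assumes "A \<squnion> U = C \<squnion> U"
    and "A \<in> carrier \<B>" "C \<in> carrier \<B>" "U \<in> carrier \<B>" "V \<in> carrier \<B>"
  shows "A \<squnion> (U \<squnion> V) = C \<squnion> (U \<squnion> V)"
  using assms by (metis join_assoc)

lemma gba_class_eq_iff: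
  assumes K: "gba_ideal \<B> K" and A: "A \<in> carrier \<B>" and C: "C \<in> carrier \<B>"
  shows "gba_class \<B> K A = gba_class \<B> K C \<longleftrightarrow> (\<exists>U\<in>K. A \<squnion> U = C \<squnion> U)"
proof
  assume "gba_class \<B> K A = gba_class \<B> K C"
  moreover have "C \<in> gba_class \<B> K C"
    using C ideal_zero[OF K] by (auto simp: gba_class_def)
  ultimately show "\<exists>U\<in>K. A \<squnion> U = C \<squnion> U"
    by (auto simp: gba_class_def)
next
  have *: "\<exists>U\<in>K. Y \<squnion> U = Z \<squnion> U"
    if XY: "\<exists>U\<in>K. X \<squnion> U = Y \<squnion> U" and XZ: "\<exists>U\<in>K. X \<squnion> U = Z \<squnion> U"
      and mem: "X \<in> carrier \<B>" "Y \<in> carrier \<B>" "Z \<in> carrier \<B>" for X Y Z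
  proof -
    obtain U V where UV: "U \<in> K" "V \<in> K" "X \<squnion> U = Y \<squnion> U" "X \<squnion> V = Z \<squnion> V"
      using XY XZ by blast
    then have "U \<in> carrier \<B>" "V \<in> carrier \<B>" "U \<squnion> V \<in> K"
      using K by (auto intro: ideal_carrier ideal_join)
    moreover from this have "Y \<squnion> (U \<squnion> V) = Z \<squnion> (U \<squnion> V)"
      using join_eq_mono[OF UV(3), of V] join_eq_mono[OF UV(4), of U] mem join_comm[of U V]
      by simp
    ultimately show ?thesis by blast
  qed
  assume "\<exists>U\<in>K. A \<squnion> U = C \<squnion> U"
  then show "gba_class \<B> K A = gba_class \<B> K C"
    unfolding gba_class_def using *[of A C] *[of C A] A C by (auto; metis)
qed

lemma gba_class_join:
  assumes K: "gba_ideal \<B> K"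
    and eq: "gba_class \<B> K A = gba_class \<B> K A'" "gba_class \<B> K C = gba_class \<B> K C'"
    and mem: "A \<in> carrier \<B>" "A' \<in> carrier \<B>" "C \<in> carrier \<B>" "C' \<in> carrier \<B>"
  shows "gba_class \<B> K (A \<squnion> C) = gba_class \<B> K (A' \<squnion> C')"
proof -
  obtain U V where UV: "U \<in> K" "A \<squnion> U = A' \<squnion> U" "V \<in> K" "C \<squnion> V = C' \<squnion> V"
    using eq K mem by (auto simp: gba_class_eq_iff)
  have c: "U \<in> carrier \<B>" "V \<in> carrier \<B>"
    using K UV by (auto intro: ideal_carrier)
  have "(A \<squnion> C) \<squnion> (U \<squnion> V) = (A \<squnion> U) \<squnion> (C \<squnion> V)"
    using mem c by (simp add: join_ac)
  also have "\<dots> = (A' \<squnion> U) \<squnion> (C' \<squnion> V)"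
    using UV by simp
  also have "\<dots> = (A' \<squnion> C') \<squnion> (U \<squnion> V)"
    using mem c by (simp add: join_ac)
  finally have "(A \<squnion> C) \<squnion> (U \<squnion> V) = (A' \<squnion> C') \<squnion> (U \<squnion> V)" .
  then show ?thesis
    using UV c mem K by (auto simp: gba_class_eq_iff intro: ideal_join)
qed

lemma gba_class_meet:
  assumes K: "gba_ideal \<B> K"
    and eq: "gba_class \<B> K A = gba_class \<B> K A'" "gba_class \<B> K C = gba_class \<B> K C'"
    and mem: "A \<in> carrier \<B>" "A' \<in> carrier \<B>" "C \<in> carrier \<B>" "C' \<in> carrier \<B>"
  shows "gba_class \<B> K (A \<sqinter> C) = gba_class \<B> K (A' \<sqinter> C')"
proof -
  obtain U V where UV: "U \<in> K" "A \<squnion> U = A' \<squnion> U" "V \<in> K" "C \<squnion> V = C' \<squnion> V"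
    using eq K mem by (auto simp: gba_class_eq_iff)
  have c: "U \<in> carrier \<B>" "V \<in> carrier \<B>"
    using K UV by (auto intro: ideal_carrier)
  then have "(A \<sqinter> C) \<squnion> (U \<squnion> V) = (A' \<sqinter> C') \<squnion> (U \<squnion> V)"
    using mem join_eq_mono[OF UV(2), of V] join_eq_mono[OF UV(4), of U] join_comm[of U V]
    by (simp add: join_meet_distrib2)
  then show ?thesis
    using UV c mem K by (auto simp: gba_class_eq_iff intro: ideal_join)
qed

lemma mem_gba_class:
  assumes "gba_ideal \<B> K" "A \<in> carrier \<B>"
  shows "C \<in> gba_class \<B> K A \<longleftrightarrow> C \<in> carrier \<B> \<and> gba_class \<B> K C = gba_class \<B> K A"
  using assms gba_class_eq_iff[of K A C] unfolding gba_class_def by auto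

lemma quotient_join:
  assumes K: "gba_ideal \<B> K" and mem: "A \<in> carrier \<B>" "C \<in> carrier \<B>"
  shows "gba_class \<B> K A \<squnion>\<^bsub>gba_quotient \<B> K\<^esub> gba_class \<B> K C = gba_class \<B> K (A \<squnion> C)"
proof -
  have "gba_class \<B> K (X \<squnion> Y) = gba_class \<B> K (A \<squnion> C)"
    if "X \<in> gba_class \<B> K A" "Y \<in> gba_class \<B> K C" for X Y
    using that mem K by (intro gba_class_join) (auto simp: mem_gba_class)
  moreover have "A \<in> gba_class \<B> K A" "C \<in> gba_class \<B> K C"
    using mem K by (auto simp: mem_gba_class)
  ultimately show ?thesis
    unfolding gba_quotient_def gba.simps by blast
qed

lemma quotient_meet:
  assumes K: "gba_ideal \<B> K" and mem: "A \<in> carrier \<B>" "C \<in> carrier \<B>"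
  shows "gba_class \<B> K A \<sqinter>\<^bsub>gba_quotient \<B> K\<^esub> gba_class \<B> K C = gba_class \<B> K (A \<sqinter> C)"
proof -
  have "gba_class \<B> K (X \<sqinter> Y) = gba_class \<B> K (A \<sqinter> C)"
    if "X \<in> gba_class \<B> K A" "Y \<in> gba_class \<B> K C" for X Y
    using that mem K by (intro gba_class_meet) (auto simp: mem_gba_class)
  moreover have "A \<in> gba_class \<B> K A" "C \<in> gba_class \<B> K C"
    using mem K by (auto simp: mem_gba_class)
  ultimately show ?thesis
    unfolding gba_quotient_def gba.simps by blast
qed

end


section \<open>Regular elements\<close>

context relative_gbds
begin

text \<open>
  The prefix \<open>t\<close> marks the data of the associated system.
\<close>

abbreviation "\<Delta> \<equiv> gbds_Delta \<B> \<L> \<theta>"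
abbreviation "reg \<equiv> gbds_reg \<B> \<L> \<theta>"
abbreviation "cls \<equiv> gba_class \<B> \<J>"
abbreviation "tB \<equiv> assoc_gba \<B> \<L> \<theta> \<J>"
abbreviation "t\<theta> \<equiv> assoc_theta \<B> \<J> \<theta>"
abbreviation "t\<I> \<equiv> assoc_ideal \<B> \<J> \<I>"
abbreviation "treg \<equiv> gbds_reg tB \<L> t\<theta>"

lemma theta_closed [simp]: "\<alpha> \<in> \<L> \<Longrightarrow> A \<in> carrier \<B> \<Longrightarrow> \<theta> \<alpha> A \<in> carrier \<B>"
  using theta_morphism by (force simp: gba_morphism_def)

lemma theta_zero [simp]: "\<alpha> \<in> \<L> \<Longrightarrow> \<theta> \<alpha> \<emptyset> = \<emptyset>"
  using theta_morphism by (force simp: gba_morphism_def)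

lemma theta_join [simp]:
  "\<alpha> \<in> \<L> \<Longrightarrow> A \<in> carrier \<B> \<Longrightarrow> C \<in> carrier \<B> \<Longrightarrow> \<theta> \<alpha> (A \<squnion> C) = \<theta> \<alpha> A \<squnion> \<theta> \<alpha> C"
  using theta_morphism by (force simp: gba_morphism_def)

lemma theta_meet [simp]:
  "\<alpha> \<in> \<L> \<Longrightarrow> A \<in> carrier \<B> \<Longrightarrow> C \<in> carrier \<B> \<Longrightarrow> \<theta> \<alpha> (A \<sqinter> C) = \<theta> \<alpha> A \<sqinter> \<theta> \<alpha> C"
  using theta_morphism by (force simp: gba_morphism_def)

lemma I_carrier [simp]: "\<alpha> \<in> \<L> \<Longrightarrow> A \<in> \<I> \<alpha> \<Longrightarrow> A \<in> carrier \<B>"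
  using ideal_I ideal_carrier by blast

lemma I_meet [simp]: "\<alpha> \<in> \<L> \<Longrightarrow> A \<in> \<I> \<alpha> \<Longrightarrow> C \<in> carrier \<B> \<Longrightarrow> A \<sqinter> C \<in> \<I> \<alpha>"
  using ideal_I ideal_meet by blast

lemma I_theta [simp]: "\<alpha> \<in> \<L> \<Longrightarrow> A \<in> carrier \<B> \<Longrightarrow> \<theta> \<alpha> A \<in> \<I> \<alpha>"
  using range_subset_I[of \<alpha>] by (force simp: bleq_def)

lemma I_zero [simp]: "\<alpha> \<in> \<L> \<Longrightarrow> \<emptyset> \<in> \<I> \<alpha>"
  using ideal_I ideal_zero by blast

lemma Delta_subset: "\<alpha> \<in> \<Delta> A \<Longrightarrow> \<alpha> \<in> \<L>"
  by (simp add: gbds_Delta_def)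

lemma Delta_zero [simp]: "\<Delta> \<emptyset> = {}"
  by (auto simp: gbds_Delta_def)

lemma Delta_join:
  "A \<in> carrier \<B> \<Longrightarrow> C \<in> carrier \<B> \<Longrightarrow> \<Delta> (A \<squnion> C) = \<Delta> A \<union> \<Delta> C"
  by (auto simp: gbds_Delta_def join_eq_zero_iff)

lemma Delta_meet: "A \<in> carrier \<B> \<Longrightarrow> C \<in> carrier \<B> \<Longrightarrow> \<Delta> (A \<sqinter> C) \<subseteq> \<Delta> A"
  by (auto simp: gbds_Delta_def)

lemma reg_carrier: "A \<in> reg \<Longrightarrow> A \<in> carrier \<B>"
  by (simp add: gbds_reg_def)

lemma reg_finite_Delta: "A \<in> reg \<Longrightarrow> finite (\<Delta> A)"
proof (cases "A = \<emptyset>")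
  case False
  assume A: "A \<in> reg"
  then have "A \<sqsubseteq> A"
    by (simp add: bleq_def reg_carrier)
  with A False show ?thesis
    unfolding gbds_reg_def by blast
qed simp

lemma reg_ideal: "gba_ideal \<B> reg"
  unfolding gba_ideal_def
proof (intro conjI ballI)
  have "\<emptyset> \<in> reg"
    by (auto simp: gbds_reg_def bleq_def)
  then show "reg \<noteq> {}" by blast
  show "reg \<subseteq> carrier \<B>"
    by (auto intro: reg_carrier)
next
  fix U A assume U: "U \<in> reg" and A: "A \<in> carrier \<B>"
  have "C \<sqsubseteq> U" if "C \<in> carrier \<B>" "C \<sqsubseteq> U \<sqinter> A" for C
    using that U A unfolding bleq_def by (metis meet_assoc meet_closed meet_comm meet_idem reg_carrier)
  with U A show "U \<sqinter> A \<in> reg"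
    by (auto simp: gbds_reg_def)
next
  fix U V assume U: "U \<in> reg" and V: "V \<in> reg"
  then have UV [simp]: "U \<in> carrier \<B>" "V \<in> carrier \<B>"
    by (auto intro: reg_carrier)
  have *: "finite (\<Delta> C) \<and> (C \<noteq> \<emptyset> \<longrightarrow> \<Delta> C \<noteq> {})" if "C \<in> carrier \<B>" "C \<sqsubseteq> W" "W \<in> reg" for C W
    using that by (cases "C = \<emptyset>") (auto simp: gbds_reg_def card_gt_0_iff)
  have "finite (\<Delta> C) \<and> \<Delta> C \<noteq> {}"
    if C: "C \<in> carrier \<B>" "C \<noteq> \<emptyset>" "C \<sqsubseteq> U \<squnion> V" for C
  proof -
    have eq: "C = (C \<sqinter> U) \<squnion> (C \<sqinter> V)"
      using C by (simp add: bleq_def meet_join_distrib)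
    have "C \<sqinter> U \<sqsubseteq> U" "C \<sqinter> V \<sqsubseteq> V"
      using C by (auto simp: bleq_def meet_assoc)
    then have "finite (\<Delta> (C \<sqinter> U)) \<and> (C \<sqinter> U \<noteq> \<emptyset> \<longrightarrow> \<Delta> (C \<sqinter> U) \<noteq> {})"
      "finite (\<Delta> (C \<sqinter> V)) \<and> (C \<sqinter> V \<noteq> \<emptyset> \<longrightarrow> \<Delta> (C \<sqinter> V) \<noteq> {})"
      using C U V * by auto
    moreover have "\<Delta> C = \<Delta> (C \<sqinter> U) \<union> \<Delta> (C \<sqinter> V)"
      using C eq Delta_join[of "C \<sqinter> U" "C \<sqinter> V"] by simp
    moreover have "C \<sqinter> U \<noteq> \<emptyset> \<or> C \<sqinter> V \<noteq> \<emptyset>"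
      using eq C by auto
    ultimately show ?thesis by auto
  qed
  with U V show "U \<squnion> V \<in> reg"
    by (auto simp: gbds_reg_def card_gt_0_iff)
qed

declare reg_carrier [simp]

lemma reg_join [simp]: "A \<in> reg \<Longrightarrow> C \<in> reg \<Longrightarrow> A \<squnion> C \<in> reg"
  using reg_ideal ideal_join by blast

lemma reg_meet [simp]: "A \<in> reg \<Longrightarrow> C \<in> carrier \<B> \<Longrightarrow> A \<sqinter> C \<in> reg"
  using reg_ideal ideal_meet by blast

lemma reg_meet2 [simp]: "A \<in> reg \<Longrightarrow> C \<in> carrier \<B> \<Longrightarrow> C \<sqinter> A \<in> reg"
  by (metis reg_meet meet_comm reg_carrier)

lemma reg_zero [simp]: "\<emptyset> \<in> reg"
  using reg_ideal ideal_zero by blast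

lemma J_reg [simp]: "A \<in> \<J> \<Longrightarrow> A \<in> reg"
  using ideal_J by (auto simp: gba_ideal_def)

lemma J_ideal: "gba_ideal \<B> \<J>"
proof -
  have "U \<sqinter> A \<in> \<J>" if "U \<in> \<J>" "A \<in> carrier \<B>" for U A
  proof -
    have "U \<sqinter> A \<in> reg"
      using that by simp
    then have "U \<sqinter> (U \<sqinter> A) \<in> \<J>"
      using ideal_J that by (simp add: gba_ideal_def del: meet_left_idem)
    then show ?thesis
      using that by simp
  qed
  then show ?thesis
    using ideal_J by (auto simp: gba_ideal_def)
qed

lemma cls_eq_iff:
  "A \<in> carrier \<B> \<Longrightarrow> C \<in> carrier \<B> \<Longrightarrow> cls A = cls C \<longleftrightarrow> (\<exists>U\<in>\<J>. A \<squnion> U = C \<squnion> U)"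
  by (rule gba_class_eq_iff[OF J_ideal])


section \<open>The associated system\<close>

lemma tB_zero: "\<emptyset>\<^bsub>tB\<^esub> = (\<emptyset>, cls \<emptyset>)"
  by (simp add: assoc_gba_def Let_def gba_quotient_def)

lemma tB_join:
  "C \<in> carrier \<B> \<Longrightarrow> C' \<in> carrier \<B> \<Longrightarrow>
    (A, cls C) \<squnion>\<^bsub>tB\<^esub> (A', cls C') = (A \<squnion> A', cls (C \<squnion> C'))"
  by (simp add: assoc_gba_def Let_def quotient_join[OF J_ideal])

lemma tB_meet:
  "C \<in> carrier \<B> \<Longrightarrow> C' \<in> carrier \<B> \<Longrightarrow>
    (A, cls C) \<sqinter>\<^bsub>tB\<^esub> (A', cls C') = (A \<sqinter> A', cls (C \<sqinter> C'))"
  by (simp add: assoc_gba_def Let_def quotient_meet[OF J_ideal])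

lemma t\<theta>_pair [simp]: "t\<theta> \<alpha> (A, X) = (\<theta> \<alpha> A, cls (\<theta> \<alpha> A))"
  by (simp add: assoc_theta_def)

lemma tB_carrierE:
  assumes "Y \<in> carrier tB"
  obtains A C W where "Y = (A, cls C)" "A \<in> carrier \<B>" "C \<in> carrier \<B>" "W \<in> reg"
    "A \<squnion> W = C \<squnion> W"
  using assms by (auto simp: assoc_gba_def Let_def gba_class_eq_iff[OF reg_ideal])

lemma tB_carrierI:
  assumes "A \<in> carrier \<B>" "C \<in> carrier \<B>" "W \<in> reg" "A \<squnion> W = C \<squnion> W"
  shows "(A, cls C) \<in> carrier tB"
proof -
  have "gba_class \<B> reg A = gba_class \<B> reg C"
    using assms by (subst gba_class_eq_iff[OF reg_ideal]) auto
  with assms(1,2) have "\<exists>A' C'. (A, cls C) = (A', cls C') \<and> A' \<in> carrier \<B> \<and> C' \<in> carrier \<B>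
      \<and> gba_class \<B> reg A' = gba_class \<B> reg C'"
    by blast
  then show ?thesis
    unfolding assoc_gba_def Let_def partial_object.simps mem_Collect_eq .
qed

text \<open>
  The representative \<open>C\<close> of the second coordinate is arbitrary, because \<open>\<J>\<close> consists of regular
  elements.
\<close>

lemma tB_carrier_iff:
  assumes "A \<in> carrier \<B>" "C \<in> carrier \<B>"
  shows "(A, cls C) \<in> carrier tB \<longleftrightarrow> (\<exists>W\<in>reg. A \<squnion> W = C \<squnion> W)"
proof
  assume "(A, cls C) \<in> carrier tB"
  then obtain C' W where C': "cls C' = cls C" "C' \<in> carrier \<B>" "W \<in> reg" "A \<squnion> W = C' \<squnion> W"
    by (auto elim: tB_carrierE)
  then obtain U where U: "U \<in> \<J>" "C' \<squnion> U = C \<squnion> U"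
    using assms by (auto simp: cls_eq_iff)
  have "A \<squnion> (W \<squnion> U) = C' \<squnion> (W \<squnion> U)"
    using assms C' U by (intro join_eq_mono) auto
  also have "\<dots> = C \<squnion> (W \<squnion> U)"
    using join_eq_mono[OF U(2), of W] join_comm[of W U] assms C' U by simp
  finally show "\<exists>W\<in>reg. A \<squnion> W = C \<squnion> W"
    using C' U by (intro bexI[of _ "W \<squnion> U"]) auto
qed (use assms tB_carrierI in blast)

lemma tB_diag [simp]: "A \<in> carrier \<B> \<Longrightarrow> (A, cls A) \<in> carrier tB"
  by (rule tB_carrierI[of _ _ "\<emptyset>"]) auto

lemma tB_meet_closed: "Y \<in> carrier tB \<Longrightarrow> Z \<in> carrier tB \<Longrightarrow> Y \<sqinter>\<^bsub>tB\<^esub> Z \<in> carrier tB"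
proof -
  assume "Y \<in> carrier tB" "Z \<in> carrier tB"
  then obtain A C W A' C' W' where
    Y: "Y = (A, cls C)" "A \<in> carrier \<B>" "C \<in> carrier \<B>" "W \<in> reg" "A \<squnion> W = C \<squnion> W" and
    Z: "Z = (A', cls C')" "A' \<in> carrier \<B>" "C' \<in> carrier \<B>" "W' \<in> reg" "A' \<squnion> W' = C' \<squnion> W'"
    by (elim tB_carrierE)
  have "(A \<sqinter> A') \<squnion> (W \<squnion> W') = (C \<sqinter> C') \<squnion> (W \<squnion> W')"
    using join_eq_mono[OF Y(5), of W'] join_eq_mono[OF Z(5), of W] join_comm[of W W'] Y Z
    by (simp add: join_meet_distrib2)
  with Y Z show ?thesis
    by (auto simp: tB_meet intro!: tB_carrierI[of _ _ "W \<squnion> W'"])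
qed

lemma tB_join_closed: "Y \<in> carrier tB \<Longrightarrow> Z \<in> carrier tB \<Longrightarrow> Y \<squnion>\<^bsub>tB\<^esub> Z \<in> carrier tB"
proof -
  assume "Y \<in> carrier tB" "Z \<in> carrier tB"
  then obtain A C W A' C' W' where
    Y: "Y = (A, cls C)" "A \<in> carrier \<B>" "C \<in> carrier \<B>" "W \<in> reg" "A \<squnion> W = C \<squnion> W" and
    Z: "Z = (A', cls C')" "A' \<in> carrier \<B>" "C' \<in> carrier \<B>" "W' \<in> reg" "A' \<squnion> W' = C' \<squnion> W'"
    by (elim tB_carrierE)
  have "(A \<squnion> A') \<squnion> (W \<squnion> W') = (A \<squnion> (W \<squnion> W')) \<squnion> (A' \<squnion> (W' \<squnion> W))"
    using Y(2-4) Z(2-4) by (simp add: join_ac)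
  also have "\<dots> = (C \<squnion> (W \<squnion> W')) \<squnion> (C' \<squnion> (W' \<squnion> W))"
    using join_eq_mono[OF Y(5), of W'] join_eq_mono[OF Z(5), of W] Y(2-4) Z(2-4) by simp
  also have "\<dots> = (C \<squnion> C') \<squnion> (W \<squnion> W')"
    using Y(2-4) Z(2-4) by (simp add: join_ac)
  finally show ?thesis
    using Y Z by (auto simp: tB_join intro!: tB_carrierI[of _ _ "W \<squnion> W'"])
qed

lemma t\<theta>_closed: "\<alpha> \<in> \<L> \<Longrightarrow> Y \<in> carrier tB \<Longrightarrow> t\<theta> \<alpha> Y \<in> carrier tB"
  by (auto elim: tB_carrierE)

lemma tDelta: "gbds_Delta tB \<L> t\<theta> (A, X) = \<Delta> A"
  by (auto simp: gbds_Delta_def tB_zero)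

text \<open>
  The regular elements of the associated system are the pairs \<open>(A, \<emptyset>)\<close> with \<open>A\<close> regular. If
  \<open>(A, [C])\<close> is regular, then \<open>A\<close> is, hence so is \<open>C\<close>; then \<open>(\<emptyset>, [C])\<close> lies below
  \<open>(A, [C])\<close> and is annihilated by every \<open>t\<theta> \<alpha>\<close>, which forces \<open>[C] = \<emptyset>\<close>.
\<close>

lemma treg_iff: "Y \<in> treg \<longleftrightarrow> (\<exists>A\<in>reg. Y = (A, cls \<emptyset>))"
proof
  assume Y: "Y \<in> treg"
  then have "Y \<in> carrier tB"
    by (simp add: gbds_reg_def)
  then obtain A C W where
    AC: "Y = (A, cls C)" "A \<in> carrier \<B>" "C \<in> carrier \<B>" "W \<in> reg" "A \<squnion> W = C \<squnion> W"
    by (elim tB_carrierE)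
  have below: "finite (\<Delta> (fst Z)) \<and> 0 < card (\<Delta> (fst Z))"
    if "Z \<in> carrier tB" "Z \<noteq> (\<emptyset>, cls \<emptyset>)" "Z \<sqinter>\<^bsub>tB\<^esub> Y = Z" for Z
    using Y that unfolding gbds_reg_def by (cases Z) (auto simp: bleq_def tB_zero tDelta)
  have A: "A \<in> reg"
    unfolding gbds_reg_def
  proof (intro CollectI conjI ballI impI)
    fix D assume D: "D \<in> carrier \<B>" "D \<noteq> \<emptyset> \<and> D \<sqsubseteq> A"
    have "(D \<sqinter> C) \<squnion> W = (D \<sqinter> A) \<squnion> W"
      using AC D by (simp add: join_meet_distrib2)
    then have "(D, cls (D \<sqinter> C)) \<in> carrier tB"
      using AC D by (intro tB_carrierI[of _ _ W]) (auto simp: bleq_def)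
    then have "finite (\<Delta> (fst (D, cls (D \<sqinter> C)))) \<and> 0 < card (\<Delta> (fst (D, cls (D \<sqinter> C))))"
      using AC D by (intro below) (auto simp: tB_meet bleq_def meet_assoc)
    then show "finite (\<Delta> D)" "0 < card (\<Delta> D)"
      by auto
  qed (use AC in auto)
  have "C \<sqinter> (A \<squnion> W) = C"
    using AC meet_absorb[of C W] by simp
  moreover have "C \<sqinter> (A \<squnion> W) \<in> reg"
    using A AC(3,4) by simp
  ultimately have "C \<in> reg"
    by simp
  then have "(\<emptyset>, cls C) \<in> carrier tB"
    using AC by (intro tB_carrierI[of _ _ C]) auto
  then have "cls C = cls \<emptyset>"
    using below[of "(\<emptyset>, cls C)"] AC by (auto simp: tB_meet)
  with A AC show "\<exists>A\<in>reg. Y = (A, cls \<emptyset>)"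
    by auto
next
  assume "\<exists>A\<in>reg. Y = (A, cls \<emptyset>)"
  then obtain A where A: "A \<in> reg" "Y = (A, cls \<emptyset>)"
    by blast
  show "Y \<in> treg"
    unfolding gbds_reg_def
  proof (intro CollectI conjI ballI impI)
    show "Y \<in> carrier tB"
      unfolding A using A by (intro tB_carrierI[of _ _ A]) auto
  next
    fix Z assume Z: "Z \<in> carrier tB" "Z \<noteq> \<emptyset>\<^bsub>tB\<^esub> \<and> Z \<sqsubseteq>\<^bsub>tB\<^esub> Y"
    then obtain C D where CD: "Z = (C, cls D)" "C \<in> carrier \<B>" "D \<in> carrier \<B>"
      by (elim tB_carrierE)
    then have "C \<sqinter> A = C" "cls D = cls \<emptyset>"
      using Z A by (auto simp: bleq_def tB_meet)
    moreover from this have "C \<noteq> \<emptyset>"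
      using Z CD by (auto simp: tB_zero)
    ultimately show "finite (gbds_Delta tB \<L> t\<theta> Z)" "0 < card (gbds_Delta tB \<L> t\<theta> Z)"
      using A CD unfolding gbds_reg_def by (auto simp: tDelta bleq_def)
  qed
qed

lemma tI_iff: "Y \<in> t\<I> \<alpha> \<longleftrightarrow> (\<exists>A\<in>\<I> \<alpha>. Y = (A, cls A))"
  by (auto simp: assoc_ideal_def)

end

section \<open>Gap projections\<close>

text \<open>
  A relative generalized Boolean dynamical system together with a coefficient ring; the type argument
  \<open>coeffs\<close> only serves to fix the type of the coefficients in the abbreviations below.
\<close>

locale relative_gbds_algebra = relative_gbds \<B> \<L> \<theta> \<I> \<J>
  for \<B> :: "'b gba" (structure)
    and \<L> :: "'l set"
    and \<theta> :: "'l \<Rightarrow> 'b \<Rightarrow> 'b"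
    and \<I> :: "'l \<Rightarrow> 'b set"
    and \<J> :: "'b set" +
  fixes coeffs :: "'r::{comm_ring, comm_monoid_mult} itself"
begin

abbreviation "gens \<equiv> gbds_gens \<B> \<L> \<I>"
abbreviation rels :: "(('r, 'l, 'b) gbds_free \<times> ('r, 'l, 'b) gbds_free) set"
  where "rels \<equiv> gbds_rels \<B> \<L> \<theta> \<I> \<J>"
abbreviation q :: "'b \<Rightarrow> ('r, 'l, 'b) gbds_free"
  where "q \<equiv> gap_proj \<B> \<L> \<theta>"
abbreviation cong :: "('r, 'l, 'b) gbds_free \<Rightarrow> ('r, 'l, 'b) gbds_free \<Rightarrow> bool" (infix "\<approx>" 50)
  where "x \<approx> y \<equiv> rcong gens rels x y"

lemma gens_iff [simp]:
  "Proj A \<in> gens \<longleftrightarrow> A \<in> carrier \<B>"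
  "Part \<alpha> A \<in> gens \<longleftrightarrow> \<alpha> \<in> \<L> \<and> A \<in> \<I> \<alpha>"
  "PartStar \<alpha> A \<in> gens \<longleftrightarrow> \<alpha> \<in> \<L> \<and> A \<in> \<I> \<alpha>"
  by (auto simp: gbds_gens_def)

lemma q_closed [simp]: "W \<in> carrier \<B> \<Longrightarrow> q W \<in> free_alg gens"
  by (auto simp: gap_proj_def gbds_Delta_def intro!: free_alg_diff free_alg_sum free_alg_mult)

lemma rels_closed:
  "(u, v) \<in> rels \<Longrightarrow> u \<in> free_alg gens \<and> v \<in> free_alg gens"
  by (induction rule: gbds_rels.induct)
     (auto simp: gbds_Delta_def intro!: free_alg_sum free_alg_mult)

lemma cong_pr_zero: "pr \<emptyset> \<approx> 0"
  by (rule rcong_rel[OF gbds_rels.pr_zero])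

lemma pr_mult: "A \<in> carrier \<B> \<Longrightarrow> C \<in> carrier \<B> \<Longrightarrow> pr A * pr C \<approx> pr (A \<sqinter> C)"
  by (rule rcong_sym, rule rcong_rel[OF gbds_rels.pr_meet])

lemma cong_pr_join:
  "A \<in> carrier \<B> \<Longrightarrow> C \<in> carrier \<B> \<Longrightarrow> pr (A \<squnion> C) \<approx> pr A + pr C - pr (A \<sqinter> C)"
  by (rule rcong_rel[OF gbds_rels.pr_join])

lemma cong_pr_ps: "A \<in> carrier \<B> \<Longrightarrow> \<alpha> \<in> \<L> \<Longrightarrow> B \<in> \<I> \<alpha> \<Longrightarrow> pr A * ps \<alpha> B \<approx> ps \<alpha> B * pr (\<theta> \<alpha> A)"
  by (rule rcong_rel[OF gbds_rels.pr_ps])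

lemma cong_ps_star_pr:
  "A \<in> carrier \<B> \<Longrightarrow> \<alpha> \<in> \<L> \<Longrightarrow> B \<in> \<I> \<alpha> \<Longrightarrow> ps_star \<alpha> B * pr A \<approx> pr (\<theta> \<alpha> A) * ps_star \<alpha> B"
  by (rule rcong_rel[OF gbds_rels.ps_star_pr])

lemma cong_ps_star_ps:
  "\<alpha> \<in> \<L> \<Longrightarrow> B \<in> \<I> \<alpha> \<Longrightarrow> \<beta> \<in> \<L> \<Longrightarrow> C \<in> \<I> \<beta> \<Longrightarrow>
    ps_star \<alpha> B * ps \<beta> C \<approx> (if \<alpha> = \<beta> then pr (B \<sqinter> C) else 0)"
  by (rule rcong_rel[OF gbds_rels.ps_star_ps])

lemma cong_ps_pr: "\<alpha> \<in> \<L> \<Longrightarrow> B \<in> \<I> \<alpha> \<Longrightarrow> A \<in> carrier \<B> \<Longrightarrow> ps \<alpha> B * pr A \<approx> ps \<alpha> (B \<sqinter> A)"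
  by (rule rcong_rel[OF gbds_rels.ps_pr]) auto

lemma cong_pr_ps_star:
  "\<alpha> \<in> \<L> \<Longrightarrow> B \<in> \<I> \<alpha> \<Longrightarrow> A \<in> carrier \<B> \<Longrightarrow> pr A * ps_star \<alpha> B \<approx> ps_star \<alpha> (B \<sqinter> A)"
  by (rule rcong_rel[OF gbds_rels.pr_ps_star]) auto

lemma q_J: "U \<in> \<J> \<Longrightarrow> q U \<approx> 0"
  using rel_ideal.rel[OF gbds_rels.pr_sum] by (simp add: gap_proj_def rcong_def)

lemma ps_zero: "\<alpha> \<in> \<L> \<Longrightarrow> ps \<alpha> \<emptyset> \<approx> 0"
proof -
  assume \<alpha>: "\<alpha> \<in> \<L>"
  have "ps \<alpha> \<emptyset> \<approx> ps \<alpha> \<emptyset> * pr \<emptyset>"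
    using cong_ps_pr[of \<alpha> \<emptyset> \<emptyset>, THEN rcong_sym] \<alpha> by simp
  also have "\<dots> \<approx> ps \<alpha> \<emptyset> * 0"
    using \<alpha> by (intro rcong_mult_left cong_pr_zero) simp
  finally show ?thesis by simp
qed

lemma ps_star_zero: "\<alpha> \<in> \<L> \<Longrightarrow> ps_star \<alpha> \<emptyset> \<approx> 0"
proof -
  assume \<alpha>: "\<alpha> \<in> \<L>"
  have "ps_star \<alpha> \<emptyset> \<approx> pr \<emptyset> * ps_star \<alpha> \<emptyset>"
    using cong_pr_ps_star[of \<alpha> \<emptyset> \<emptyset>, THEN rcong_sym] \<alpha> by simp
  also have "\<dots> \<approx> 0 * ps_star \<alpha> \<emptyset>"
    using \<alpha> by (intro rcong_mult_right cong_pr_zero) simp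
  finally show ?thesis by simp
qed

text \<open>
  The range projections \<open>s s\<^sup>*\<close> are cut down by projections from either side in the same way; this is
  what makes gap projections commute with all projections \<open>p\<close>.
\<close>

lemma range_proj_meet:
  assumes "\<alpha> \<in> \<L>" "B \<in> \<I> \<alpha>" "A \<in> carrier \<B>"
  shows "ps \<alpha> B * pr A * ps_star \<alpha> B \<approx> ps \<alpha> (B \<sqinter> A) * ps_star \<alpha> (B \<sqinter> A)"
proof -
  have "ps \<alpha> B * pr A * ps_star \<alpha> B \<approx> ps \<alpha> B * (pr A * pr A) * ps_star \<alpha> B"
    using assms pr_mult[of A A, THEN rcong_sym]
    by (intro rcong_mult_right rcong_mult_left) auto
  also have "\<dots> = (ps \<alpha> B * pr A) * (pr A * ps_star \<alpha> B)"
    by (simp add: mult.assoc)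
  also have "\<dots> \<approx> ps \<alpha> (B \<sqinter> A) * ps_star \<alpha> (B \<sqinter> A)"
    using assms by (intro rcong_mult cong_ps_pr cong_pr_ps_star) auto
  finally show ?thesis .
qed

lemma pr_range_proj:
  assumes "\<alpha> \<in> \<L>" "B \<in> \<I> \<alpha>" "A \<in> carrier \<B>"
  shows "pr A * (ps \<alpha> B * ps_star \<alpha> B) \<approx> ps \<alpha> (B \<sqinter> \<theta> \<alpha> A) * ps_star \<alpha> (B \<sqinter> \<theta> \<alpha> A)"
proof -
  have "pr A * ps \<alpha> B * ps_star \<alpha> B \<approx> ps \<alpha> B * pr (\<theta> \<alpha> A) * ps_star \<alpha> B"
    using assms by (intro rcong_mult_right cong_pr_ps) auto
  also have "\<dots> \<approx> ps \<alpha> (B \<sqinter> \<theta> \<alpha> A) * ps_star \<alpha> (B \<sqinter> \<theta> \<alpha> A)"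
    using assms by (intro range_proj_meet) auto
  finally show ?thesis
    by (simp add: mult.assoc)
qed

lemma range_proj_pr:
  assumes "\<alpha> \<in> \<L>" "B \<in> \<I> \<alpha>" "A \<in> carrier \<B>"
  shows "ps \<alpha> B * ps_star \<alpha> B * pr A \<approx> ps \<alpha> (B \<sqinter> \<theta> \<alpha> A) * ps_star \<alpha> (B \<sqinter> \<theta> \<alpha> A)"
proof -
  have "ps \<alpha> B * (ps_star \<alpha> B * pr A) \<approx> ps \<alpha> B * (pr (\<theta> \<alpha> A) * ps_star \<alpha> B)"
    using assms by (intro rcong_mult_left cong_ps_star_pr) auto
  also have "\<dots> = ps \<alpha> B * pr (\<theta> \<alpha> A) * ps_star \<alpha> B"
    by (simp add: mult.assoc)
  also have "\<dots> \<approx> ps \<alpha> (B \<sqinter> \<theta> \<alpha> A) * ps_star \<alpha> (B \<sqinter> \<theta> \<alpha> A)"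
    using assms by (intro range_proj_meet) auto
  finally show ?thesis
    by (simp add: mult.assoc)
qed

lemma sum_range_proj_meet:
  assumes W: "W \<in> reg" and A: "A \<in> carrier \<B>"
  shows "(\<Sum>\<alpha>\<in>\<Delta> W. ps \<alpha> (\<theta> \<alpha> W \<sqinter> \<theta> \<alpha> A) * ps_star \<alpha> (\<theta> \<alpha> W \<sqinter> \<theta> \<alpha> A))
    \<approx> (\<Sum>\<alpha>\<in>\<Delta> (W \<sqinter> A). ps \<alpha> (\<theta> \<alpha> (W \<sqinter> A)) * ps_star \<alpha> (\<theta> \<alpha> (W \<sqinter> A)))"
proof -
  have "(\<Sum>\<alpha>\<in>\<Delta> W. ps \<alpha> (\<theta> \<alpha> W \<sqinter> \<theta> \<alpha> A) * ps_star \<alpha> (\<theta> \<alpha> W \<sqinter> \<theta> \<alpha> A))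
      = (\<Sum>\<alpha>\<in>\<Delta> W. ps \<alpha> (\<theta> \<alpha> (W \<sqinter> A)) * ps_star \<alpha> (\<theta> \<alpha> (W \<sqinter> A)))"
    using W A Delta_subset by (intro sum.cong) auto
  also have "\<dots> \<approx> (\<Sum>\<alpha>\<in>\<Delta> (W \<sqinter> A). ps \<alpha> (\<theta> \<alpha> (W \<sqinter> A)) * ps_star \<alpha> (\<theta> \<alpha> (W \<sqinter> A)))"
  proof (rule rcong_sum_superset)
    show "finite (\<Delta> W)"
      using W by (rule reg_finite_Delta)
    show "\<Delta> (W \<sqinter> A) \<subseteq> \<Delta> W"
      using W A by (intro Delta_meet) auto
  next
    fix \<alpha> assume "\<alpha> \<in> \<Delta> W - \<Delta> (W \<sqinter> A)"
    then have \<alpha>: "\<alpha> \<in> \<L>" "\<theta> \<alpha> (W \<sqinter> A) = \<emptyset>"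
      unfolding gbds_Delta_def by blast+
    have "ps \<alpha> \<emptyset> * ps_star \<alpha> \<emptyset> \<approx> 0 * ps_star \<alpha> \<emptyset>"
      using \<alpha> by (intro rcong_mult_right ps_zero) auto
    then show "ps \<alpha> (\<theta> \<alpha> (W \<sqinter> A)) * ps_star \<alpha> (\<theta> \<alpha> (W \<sqinter> A)) \<approx> 0"
      unfolding \<alpha>(2) by simp
  qed
  finally show ?thesis .
qed

lemma pr_q:
  assumes W: "W \<in> reg" and A: "A \<in> carrier \<B>"
  shows "pr A * q W \<approx> q (W \<sqinter> A)"
proof -
  have "(\<Sum>\<alpha>\<in>\<Delta> W. pr A * (ps \<alpha> (\<theta> \<alpha> W) * ps_star \<alpha> (\<theta> \<alpha> W)))
      \<approx> (\<Sum>\<alpha>\<in>\<Delta> W. ps \<alpha> (\<theta> \<alpha> W \<sqinter> \<theta> \<alpha> A) * ps_star \<alpha> (\<theta> \<alpha> W \<sqinter> \<theta> \<alpha> A))"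
    using W A by (intro rcong_sum pr_range_proj) (auto dest: Delta_subset)
  also note sum_range_proj_meet[OF W A]
  finally show ?thesis
    using W A pr_mult[of A W] unfolding gap_proj_def right_diff_distrib sum_distrib_left
    by (intro rcong_diff) (auto simp: meet_comm)
qed

lemma q_pr:
  assumes W: "W \<in> reg" and A: "A \<in> carrier \<B>"
  shows "q W * pr A \<approx> q (W \<sqinter> A)"
proof -
  have "(\<Sum>\<alpha>\<in>\<Delta> W. ps \<alpha> (\<theta> \<alpha> W) * ps_star \<alpha> (\<theta> \<alpha> W) * pr A)
      \<approx> (\<Sum>\<alpha>\<in>\<Delta> W. ps \<alpha> (\<theta> \<alpha> W \<sqinter> \<theta> \<alpha> A) * ps_star \<alpha> (\<theta> \<alpha> W \<sqinter> \<theta> \<alpha> A))"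
    using W A by (intro rcong_sum range_proj_pr) (auto dest: Delta_subset)
  also note sum_range_proj_meet[OF W A]
  finally show ?thesis
    using W A pr_mult[of W A] unfolding gap_proj_def left_diff_distrib sum_distrib_right
    by (intro rcong_diff) auto
qed

text \<open>
  Gap projections annihilate the partial isometries: both \<open>p\<^sub>W s\<close> and
  \<open>(\<Sum>\<beta>. s\<^sub>\<beta> s\<^sub>\<beta>\<^sup>*) s\<close> equal \<open>s\<close> cut down to \<open>B \<inter> \<theta>\<^sub>\<alpha>(W)\<close>.
\<close>

lemma q_ps:
  assumes W: "W \<in> reg" and \<alpha>: "\<alpha> \<in> \<L>" and B: "B \<in> \<I> \<alpha>"
  shows "q W * ps \<alpha> B \<approx> 0"
proof -
  let ?c = "if \<alpha> \<in> \<Delta> W then ps \<alpha> (\<theta> \<alpha> W) * pr (\<theta> \<alpha> W \<sqinter> B) else 0"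
  have "(\<Sum>\<beta>\<in>\<Delta> W. ps \<beta> (\<theta> \<beta> W) * ps_star \<beta> (\<theta> \<beta> W) * ps \<alpha> B)
      \<approx> (\<Sum>\<beta>\<in>\<Delta> W. if \<beta> = \<alpha> then ps \<alpha> (\<theta> \<alpha> W) * pr (\<theta> \<alpha> W \<sqinter> B) else 0)"
  proof (rule rcong_sum)
    fix \<beta> assume "\<beta> \<in> \<Delta> W"
    then have \<beta>: "\<beta> \<in> \<L>" by (rule Delta_subset)
    have "ps \<beta> (\<theta> \<beta> W) * (ps_star \<beta> (\<theta> \<beta> W) * ps \<alpha> B)
        \<approx> ps \<beta> (\<theta> \<beta> W) * (if \<beta> = \<alpha> then pr (\<theta> \<beta> W \<sqinter> B) else 0)"
      using W \<alpha> B \<beta> by (intro rcong_mult_left cong_ps_star_ps) auto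
    then show "ps \<beta> (\<theta> \<beta> W) * ps_star \<beta> (\<theta> \<beta> W) * ps \<alpha> B
        \<approx> (if \<beta> = \<alpha> then ps \<alpha> (\<theta> \<alpha> W) * pr (\<theta> \<alpha> W \<sqinter> B) else 0)"
      by (auto simp: mult.assoc)
  qed
  also have "\<dots> = ?c"
    using reg_finite_Delta[OF W] by simp
  also have "\<dots> \<approx> ps \<alpha> (B \<sqinter> \<theta> \<alpha> W)"
  proof (cases "\<alpha> \<in> \<Delta> W")
    case True
    have "ps \<alpha> (\<theta> \<alpha> W) * pr (\<theta> \<alpha> W \<sqinter> B) \<approx> ps \<alpha> (\<theta> \<alpha> W \<sqinter> (\<theta> \<alpha> W \<sqinter> B))"
      using W \<alpha> B by (intro cong_ps_pr) auto
    moreover have "\<theta> \<alpha> W \<sqinter> (\<theta> \<alpha> W \<sqinter> B) = B \<sqinter> \<theta> \<alpha> W"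
      using W \<alpha> B meet_comm[of B "\<theta> \<alpha> W"] I_carrier by simp
    ultimately show ?thesis
      using True by simp
  next
    case False
    then have "\<theta> \<alpha> W = \<emptyset>"
      using \<alpha> by (simp add: gbds_Delta_def)
    moreover have "B \<sqinter> \<emptyset> = \<emptyset>"
      using I_carrier[OF \<alpha> B] by simp
    ultimately show ?thesis
      using False ps_zero[OF \<alpha>, THEN rcong_sym] by simp
  qed
  finally have sum: "(\<Sum>\<beta>\<in>\<Delta> W. ps \<beta> (\<theta> \<beta> W) * ps_star \<beta> (\<theta> \<beta> W) * ps \<alpha> B) \<approx> ps \<alpha> (B \<sqinter> \<theta> \<alpha> W)" .
  have "pr W * ps \<alpha> B \<approx> ps \<alpha> B * pr (\<theta> \<alpha> W)"
    using W \<alpha> B by (intro cong_pr_ps) auto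
  also have "\<dots> \<approx> ps \<alpha> (B \<sqinter> \<theta> \<alpha> W)"
    using W \<alpha> B by (intro cong_ps_pr) auto
  finally show ?thesis
    using rcong_diff[OF _ sum, of "pr W * ps \<alpha> B" "ps \<alpha> (B \<sqinter> \<theta> \<alpha> W)"]
    by (simp add: gap_proj_def left_diff_distrib sum_distrib_right)
qed

lemma ps_star_q:
  assumes W: "W \<in> reg" and \<alpha>: "\<alpha> \<in> \<L>" and B: "B \<in> \<I> \<alpha>"
  shows "ps_star \<alpha> B * q W \<approx> 0"
proof -
  let ?c = "if \<alpha> \<in> \<Delta> W then pr (\<theta> \<alpha> W \<sqinter> B) * ps_star \<alpha> (\<theta> \<alpha> W) else 0"
  have "(\<Sum>\<beta>\<in>\<Delta> W. ps_star \<alpha> B * (ps \<beta> (\<theta> \<beta> W) * ps_star \<beta> (\<theta> \<beta> W)))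
      \<approx> (\<Sum>\<beta>\<in>\<Delta> W. if \<beta> = \<alpha> then pr (\<theta> \<alpha> W \<sqinter> B) * ps_star \<alpha> (\<theta> \<alpha> W) else 0)"
  proof (rule rcong_sum)
    fix \<beta> assume "\<beta> \<in> \<Delta> W"
    then have \<beta>: "\<beta> \<in> \<L>" by (rule Delta_subset)
    have "(ps_star \<alpha> B * ps \<beta> (\<theta> \<beta> W)) * ps_star \<beta> (\<theta> \<beta> W)
        \<approx> (if \<alpha> = \<beta> then pr (B \<sqinter> \<theta> \<beta> W) else 0) * ps_star \<beta> (\<theta> \<beta> W)"
      using W \<alpha> B \<beta> by (intro rcong_mult_right cong_ps_star_ps) auto
    moreover have "B \<sqinter> \<theta> \<alpha> W = \<theta> \<alpha> W \<sqinter> B"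
      using W \<alpha> B I_carrier by (intro meet_comm) auto
    ultimately show "ps_star \<alpha> B * (ps \<beta> (\<theta> \<beta> W) * ps_star \<beta> (\<theta> \<beta> W))
        \<approx> (if \<beta> = \<alpha> then pr (\<theta> \<alpha> W \<sqinter> B) * ps_star \<alpha> (\<theta> \<alpha> W) else 0)"
      by (auto simp: mult.assoc)
  qed
  also have "\<dots> = ?c"
    using reg_finite_Delta[OF W] by simp
  also have "\<dots> \<approx> ps_star \<alpha> (B \<sqinter> \<theta> \<alpha> W)"
  proof (cases "\<alpha> \<in> \<Delta> W")
    case True
    have "pr (\<theta> \<alpha> W \<sqinter> B) * ps_star \<alpha> (\<theta> \<alpha> W) \<approx> ps_star \<alpha> (\<theta> \<alpha> W \<sqinter> (\<theta> \<alpha> W \<sqinter> B))"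
      using W \<alpha> B by (intro cong_pr_ps_star) auto
    moreover have "\<theta> \<alpha> W \<sqinter> (\<theta> \<alpha> W \<sqinter> B) = B \<sqinter> \<theta> \<alpha> W"
      using W \<alpha> B meet_comm[of B "\<theta> \<alpha> W"] I_carrier by simp
    ultimately show ?thesis
      using True by simp
  next
    case False
    then have "\<theta> \<alpha> W = \<emptyset>"
      using \<alpha> by (simp add: gbds_Delta_def)
    moreover have "B \<sqinter> \<emptyset> = \<emptyset>"
      using I_carrier[OF \<alpha> B] by simp
    ultimately show ?thesis
      using False ps_star_zero[OF \<alpha>, THEN rcong_sym] by simp
  qed
  finally have sum: "(\<Sum>\<beta>\<in>\<Delta> W. ps_star \<alpha> B * (ps \<beta> (\<theta> \<beta> W) * ps_star \<beta> (\<theta> \<beta> W)))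
      \<approx> ps_star \<alpha> (B \<sqinter> \<theta> \<alpha> W)" .
  have "ps_star \<alpha> B * pr W \<approx> pr (\<theta> \<alpha> W) * ps_star \<alpha> B"
    using W \<alpha> B by (intro cong_ps_star_pr) auto
  also have "\<dots> \<approx> ps_star \<alpha> (B \<sqinter> \<theta> \<alpha> W)"
    using W \<alpha> B by (intro cong_pr_ps_star) auto
  finally show ?thesis
    using rcong_diff[OF _ sum, of "ps_star \<alpha> B * pr W" "ps_star \<alpha> (B \<sqinter> \<theta> \<alpha> W)"]
    by (simp add: gap_proj_def right_diff_distrib sum_distrib_left)
qed

lemma q_idem:
  assumes W: "W \<in> reg"
  shows "q W * q W \<approx> q W"
proof -
  have "(\<Sum>\<alpha>\<in>\<Delta> W. q W * (ps \<alpha> (\<theta> \<alpha> W) * ps_star \<alpha> (\<theta> \<alpha> W))) \<approx> (\<Sum>\<alpha>\<in>\<Delta> W. 0)"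
  proof (rule rcong_sum)
    fix \<alpha> assume "\<alpha> \<in> \<Delta> W"
    then have "\<alpha> \<in> \<L>" by (rule Delta_subset)
    then have "q W * ps \<alpha> (\<theta> \<alpha> W) * ps_star \<alpha> (\<theta> \<alpha> W) \<approx> 0 * ps_star \<alpha> (\<theta> \<alpha> W)"
      using W by (intro rcong_mult_right q_ps) auto
    then show "q W * (ps \<alpha> (\<theta> \<alpha> W) * ps_star \<alpha> (\<theta> \<alpha> W)) \<approx> 0"
      by (simp add: mult.assoc)
  qed
  then have "q W * pr W - (\<Sum>\<alpha>\<in>\<Delta> W. q W * (ps \<alpha> (\<theta> \<alpha> W) * ps_star \<alpha> (\<theta> \<alpha> W))) \<approx> q (W \<sqinter> W) - 0"
    using W q_pr[of W W] by (intro rcong_diff) auto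
  moreover have "q W * q W = q W * pr W - (\<Sum>\<alpha>\<in>\<Delta> W. q W * (ps \<alpha> (\<theta> \<alpha> W) * ps_star \<alpha> (\<theta> \<alpha> W)))"
    by (subst (2) gap_proj_def) (simp add: right_diff_distrib sum_distrib_left)
  ultimately show ?thesis
    using W by simp
qed

end

section \<open>The elements assigned to the projections of the associated system\<close>

context relative_gbds_algebra
begin

text \<open>
  The element that equals \<open>p\<^sub>C\<close> under the projection \<open>q\<^sub>W\<close> and \<open>p\<^sub>A\<close> away from it. When
  \<open>A \<union> W = C \<union> W\<close> with \<open>W\<close> regular it is the image of the projection of \<open>(A, [C])\<close>. As
  \<open>q\<^sub>W\<close> is an idempotent commuting with all projections, such elements multiply and join as the pairs
  do, provided that the same \<open>W\<close> is used for both; this form makes the disjointness conditions on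
  \<open>C\<close> and \<open>D\<close> in the expression \<open>p\<^sub>A + q\<^sub>C - q\<^sub>D\<close> superfluous.
\<close>

definition patch :: "'b \<Rightarrow> 'b \<Rightarrow> 'b \<Rightarrow> ('r, 'l, 'b) gbds_free" where
  "patch A C W = pr A + q W * (pr C - pr A)"

lemma patch_closed [simp]:
  "A \<in> carrier \<B> \<Longrightarrow> C \<in> carrier \<B> \<Longrightarrow> W \<in> reg \<Longrightarrow> patch A C W \<in> free_alg gens"
  by (simp add: patch_def)

lemma pr_diff_cong:
  assumes "A \<in> carrier \<B>" "C \<in> carrier \<B>" "W \<in> carrier \<B>" "A \<squnion> W = C \<squnion> W"
  shows "pr C - pr A \<approx> pr (C \<sqinter> W) - pr (A \<sqinter> W)"
proof -
  have "pr A + pr W - pr (A \<sqinter> W) \<approx> pr (A \<squnion> W)"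
    using assms by (intro rcong_sym[OF cong_pr_join]) auto
  also have "\<dots> \<approx> pr C + pr W - pr (C \<sqinter> W)"
    unfolding assms(4) using assms by (intro cong_pr_join) auto
  finally have "pr C + pr W - pr (C \<sqinter> W) \<approx> pr A + pr W - pr (A \<sqinter> W)"
    by (rule rcong_sym)
  then show ?thesis
    by (simp add: rcong_def algebra_simps)
qed

text \<open>
  If \<open>A\<close> and \<open>C\<close> differ only inside \<open>W\<close>, then \<open>p\<^sub>C - p\<^sub>A\<close> lives under \<open>p\<^sub>W\<close>, so that
  \<open>q\<^sub>V\<close> and \<open>q\<^sub>W\<close> act on it in the same way for every \<open>V\<close> above \<open>W\<close>.
\<close>

lemma q_diff_shrink:
  assumes "A \<in> carrier \<B>" "C \<in> carrier \<B>" "W \<in> reg" "V \<in> reg"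
    and eq: "A \<squnion> W = C \<squnion> W" and W: "W \<sqinter> V = W"
  shows "q V * (pr C - pr A) \<approx> q W * (pr C - pr A)"
proof -
  have *: "q V * pr (D \<sqinter> W) \<approx> q W * pr D" if "D \<in> carrier \<B>" for D
  proof -
    have "q V * pr (D \<sqinter> W) \<approx> q (V \<sqinter> (D \<sqinter> W))"
      using assms that by (intro q_pr) auto
    also have "V \<sqinter> (D \<sqinter> W) = (W \<sqinter> V) \<sqinter> D"
      using assms(3,4) that by (simp add: meet_ac)
    also have "\<dots> = W \<sqinter> D"
      by (simp only: W)
    also have "q (W \<sqinter> D) \<approx> q W * pr D"
      using assms that by (intro rcong_sym[OF q_pr]) auto
    finally show ?thesis .
  qed
  have "q V * (pr C - pr A) \<approx> q V * (pr (C \<sqinter> W) - pr (A \<sqinter> W))"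
    using assms by (intro rcong_mult_left pr_diff_cong) auto
  also have "\<dots> \<approx> q W * (pr C - pr A)"
    unfolding right_diff_distrib using assms by (intro rcong_diff *) auto
  finally show ?thesis .
qed

lemma patch_enlarge:
  assumes "A \<in> carrier \<B>" "C \<in> carrier \<B>" "W \<in> reg" "V \<in> reg"
    and "A \<squnion> W = C \<squnion> W" and "W \<sqinter> V = W"
  shows "patch A C W \<approx> patch A C V"
  unfolding patch_def using assms by (intro rcong_add rcong_sym[OF q_diff_shrink]) auto

text \<open>
  Independence of \<open>W\<close> and of the representative \<open>C\<close>: two representatives differ inside some
  \<open>U \<in> \<J>\<close>, and \<open>q\<^sub>U\<close> vanishes.
\<close>

lemma patch_cong:
  assumes mem: "A \<in> carrier \<B>" "C \<in> carrier \<B>" "C' \<in> carrier \<B>" "W \<in> reg" "W' \<in> reg"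
    and eq: "A \<squnion> W = C \<squnion> W" "A \<squnion> W' = C' \<squnion> W'" and cls: "cls C = cls C'"
  shows "patch A C W \<approx> patch A C' W'"
proof -
  obtain U where U: "U \<in> \<J>" "C \<squnion> U = C' \<squnion> U"
    using cls mem by (auto simp: cls_eq_iff)
  define V where "V = W \<squnion> (W' \<squnion> U)"
  have V: "V \<in> reg"
    using mem U by (simp add: V_def)
  have "W \<sqinter> V = W"
    unfolding V_def using mem U by (intro meet_absorb) auto
  moreover have "W' \<sqinter> V = W'" "U \<sqinter> V = U"
    using meet_absorb[of W' "W \<squnion> U"] meet_absorb[of U "W \<squnion> W'"] mem U
    by (simp_all add: V_def join_ac)
  ultimately have "patch A C W \<approx> patch A C V" "patch A C' W' \<approx> patch A C' V"
      and *: "q V * (pr C' - pr C) \<approx> q U * (pr C' - pr C)"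
    using mem U V eq by (auto intro!: patch_enlarge q_diff_shrink)
  note this(1)
  also have "patch A C V \<approx> patch A C' V"
  proof -
    have "q U * (pr C' - pr C) \<approx> 0 * (pr C' - pr C)"
      using mem U by (intro rcong_mult_right q_J) auto
    with * have "q V * (pr C' - pr C) \<approx> 0"
      using rcong_trans by fastforce
    then have "patch A C' V - patch A C V \<in> rel_ideal gens rels"
      by (simp add: rcong_def patch_def algebra_simps)
    then show ?thesis
      using rcong_sym by (auto simp: rcong_def)
  qed
  also note \<open>patch A C' W' \<approx> patch A C' V\<close>[THEN rcong_sym]
  finally show ?thesis .
qed

lemma patch_conv_q:
  assumes "A \<in> carrier \<B>" "C \<in> carrier \<B>" "W \<in> reg"
  shows "patch A C W \<approx> pr A + q (W \<sqinter> C) - q (W \<sqinter> A)"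
proof -
  have "pr A + (q W * pr C - q W * pr A) \<approx> pr A + (q (W \<sqinter> C) - q (W \<sqinter> A))"
    using assms by (intro rcong_add rcong_diff q_pr) auto
  then show ?thesis
    by (simp add: patch_def right_diff_distrib add_diff_eq)
qed

text \<open>
  The element \<open>p\<^sub>A + q\<^sub>C - q\<^sub>D\<close> is a special case: \<open>W = C \<union> D\<close> contains the difference of
  \<open>A\<close> and \<open>B\<close>, and \<open>p\<^sub>B - p\<^sub>A = p\<^sub>C - p\<^sub>D\<close>.
\<close>

lemma patch_split:
  assumes mem: "A \<in> carrier \<B>" "B \<in> carrier \<B>" "C \<in> reg" "D \<in> reg"
    and eq: "A \<squnion> C = B \<squnion> D" and disj: "A \<sqinter> C = \<emptyset>" "B \<sqinter> D = \<emptyset>"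
  shows "A \<squnion> (C \<squnion> D) = B \<squnion> (C \<squnion> D)"
    and "patch A B (C \<squnion> D) \<approx> pr A + q C - q D"
proof -
  have "A \<squnion> (C \<squnion> D) = (A \<squnion> C) \<squnion> D"
    using mem by (simp add: join_assoc)
  also have "\<dots> = (B \<squnion> D) \<squnion> C"
    using mem eq join_assoc[of B D D] join_assoc[of A C C] by simp
  also have "\<dots> = B \<squnion> (C \<squnion> D)"
    using mem by (simp add: join_ac)
  finally show "A \<squnion> (C \<squnion> D) = B \<squnion> (C \<squnion> D)" .
  have join_disjoint: "pr (X \<squnion> Y) \<approx> pr X + pr Y"
    if "X \<in> carrier \<B>" "Y \<in> carrier \<B>" "X \<sqinter> Y = \<emptyset>" for X Y
  proof -
    have "pr (X \<squnion> Y) \<approx> pr X + pr Y - pr (X \<sqinter> Y)"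
      using that by (intro cong_pr_join) auto
    also have "\<dots> \<approx> pr X + pr Y - 0"
      unfolding that(3) by (intro rcong_diff cong_pr_zero) auto
    finally show ?thesis by simp
  qed
  have "pr B + pr D \<approx> pr (B \<squnion> D)"
    using mem disj by (intro rcong_sym[OF join_disjoint]) auto
  also have "\<dots> \<approx> pr A + pr C"
    unfolding eq[symmetric] using mem disj by (intro join_disjoint) auto
  finally have "pr B - pr A \<approx> pr C - pr D"
    by (simp add: rcong_def algebra_simps)
  then have "q (C \<squnion> D) * (pr B - pr A) \<approx> q (C \<squnion> D) * (pr C - pr D)"
    using mem by (intro rcong_mult_left) auto
  also have "\<dots> = q (C \<squnion> D) * pr C - q (C \<squnion> D) * pr D"
    by (simp add: right_diff_distrib)
  also have "\<dots> \<approx> q ((C \<squnion> D) \<sqinter> C) - q ((C \<squnion> D) \<sqinter> D)"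
    using mem by (intro rcong_diff q_pr) auto
  also have "(C \<squnion> D) \<sqinter> C = C"
    using mem meet_absorb[of C D] meet_comm[of C "C \<squnion> D"] by simp
  also have "(C \<squnion> D) \<sqinter> D = D"
    using mem meet_absorb[of D C] meet_comm[of D "C \<squnion> D"] join_comm[of C D] by simp
  finally have "pr A + q (C \<squnion> D) * (pr B - pr A) \<approx> pr A + (q C - q D)"
    by (intro rcong_add) auto
  then show "patch A B (C \<squnion> D) \<approx> pr A + q C - q D"
    by (simp add: patch_def add_diff_eq)
qed

lemma patch_meet:
  assumes mem: "A \<in> carrier \<B>" "C \<in> carrier \<B>" "A' \<in> carrier \<B>" "C' \<in> carrier \<B>" "W \<in> reg"
  shows "patch A C W * patch A' C' W \<approx> patch (A \<sqinter> A') (C \<sqinter> C') W"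
proof -
  define e d d' :: "('r, 'l, 'b) gbds_free"
    where "e = q W" and "d = pr C - pr A" and "d' = pr C' - pr A'"
  have [simp]: "e \<in> free_alg gens" "d \<in> free_alg gens" "d' \<in> free_alg gens"
    using mem by (auto simp: e_def d_def d'_def)
  have comm: "pr X * e \<approx> e * pr X" if "X \<in> carrier \<B>" for X
    unfolding e_def using rcong_trans[OF pr_q rcong_sym[OF q_pr]] mem(5) that by blast
  have "d * e \<approx> e * d"
    unfolding d_def left_diff_distrib right_diff_distrib using mem by (intro rcong_diff comm) auto
  then have "(d * e - e * d) * d' \<approx> 0"
    by (auto simp: rcong_def intro: rel_ideal.mult_right)
  moreover have "(e * e - e) * (d * d') \<approx> 0"
    using q_idem[OF mem(5)] by (auto simp: rcong_def e_def[symmetric] intro: rel_ideal.mult_right)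
  moreover have "(pr A * e - e * pr A) * d' \<approx> 0"
    using comm[OF mem(1)] by (auto simp: rcong_def intro: rel_ideal.mult_right)
  moreover have "e * ((d * e - e * d) * d') \<approx> 0"
    using \<open>(d * e - e * d) * d' \<approx> 0\<close> by (auto simp: rcong_def intro: rel_ideal.mult_left)
  \<comment> \<open>The product differs from the claimed value by commutators with \<open>e\<close> and by \<open>e * e - e\<close>.\<close>
  ultimately have "(pr A * e - e * pr A) * d' + (e * ((d * e - e * d) * d') + (e * e - e) * (d * d'))
      \<approx> 0 + (0 + 0)"
    by (intro rcong_add)
  moreover have "patch A C W * patch A' C' W - (pr A * pr A' + e * (pr C * pr C' - pr A * pr A'))
      = (pr A * e - e * pr A) * d' + (e * ((d * e - e * d) * d') + (e * e - e) * (d * d'))"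
    by (simp add: patch_def e_def[symmetric] d_def d'_def algebra_simps)
  ultimately have "patch A C W * patch A' C' W \<approx> pr A * pr A' + e * (pr C * pr C' - pr A * pr A')"
    by (simp add: rcong_def)
  also have "\<dots> \<approx> pr (A \<sqinter> A') + e * (pr (C \<sqinter> C') - pr (A \<sqinter> A'))"
    using mem by (intro rcong_add rcong_mult_left rcong_diff pr_mult) auto
  finally show ?thesis
    by (simp add: patch_def e_def)
qed

lemma patch_join:
  assumes mem: "A \<in> carrier \<B>" "C \<in> carrier \<B>" "A' \<in> carrier \<B>" "C' \<in> carrier \<B>" "W \<in> reg"
  shows "patch (A \<squnion> A') (C \<squnion> C') W \<approx> patch A C W + patch A' C' W - patch (A \<sqinter> A') (C \<sqinter> C') W"
proof -
  have "patch (A \<squnion> A') (C \<squnion> C') W \<approx> (pr A + pr A' - pr (A \<sqinter> A'))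
      + q W * ((pr C + pr C' - pr (C \<sqinter> C')) - (pr A + pr A' - pr (A \<sqinter> A')))"
    unfolding patch_def using mem by (intro rcong_add rcong_mult_left rcong_diff cong_pr_join) auto
  then show ?thesis
    by (simp add: patch_def algebra_simps)
qed

lemma patch_diag [simp]: "patch A A W = pr A"
  by (simp add: patch_def)

lemma patch_ps:
  assumes "A \<in> carrier \<B>" "C \<in> carrier \<B>" "W \<in> reg" "\<alpha> \<in> \<L>" "B \<in> \<I> \<alpha>"
  shows "patch A C W * ps \<alpha> B \<approx> ps \<alpha> B * pr (\<theta> \<alpha> A)"
proof -
  have "patch A C W * ps \<alpha> B \<approx> (pr A + q (W \<sqinter> C) - q (W \<sqinter> A)) * ps \<alpha> B"
    using assms by (intro rcong_mult_right patch_conv_q) auto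
  also have "\<dots> = pr A * ps \<alpha> B + q (W \<sqinter> C) * ps \<alpha> B - q (W \<sqinter> A) * ps \<alpha> B"
    by (simp add: algebra_simps)
  also have "\<dots> \<approx> ps \<alpha> B * pr (\<theta> \<alpha> A) + 0 - 0"
    using assms by (intro rcong_add rcong_diff cong_pr_ps q_ps) auto
  finally show ?thesis by simp
qed

lemma ps_star_patch:
  assumes "A \<in> carrier \<B>" "C \<in> carrier \<B>" "W \<in> reg" "\<alpha> \<in> \<L>" "B \<in> \<I> \<alpha>"
  shows "ps_star \<alpha> B * patch A C W \<approx> pr (\<theta> \<alpha> A) * ps_star \<alpha> B"
proof -
  have "ps_star \<alpha> B * patch A C W \<approx> ps_star \<alpha> B * (pr A + q (W \<sqinter> C) - q (W \<sqinter> A))"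
    using assms by (intro rcong_mult_left patch_conv_q) auto
  also have "\<dots> = ps_star \<alpha> B * pr A + ps_star \<alpha> B * q (W \<sqinter> C) - ps_star \<alpha> B * q (W \<sqinter> A)"
    by (simp add: algebra_simps)
  also have "\<dots> \<approx> pr (\<theta> \<alpha> A) * ps_star \<alpha> B + 0 - 0"
    using assms by (intro rcong_add rcong_diff cong_ps_star_pr ps_star_q) auto
  finally show ?thesis by simp
qed


section \<open>The two homomorphisms\<close>

abbreviation "tgens \<equiv> gbds_gens tB \<L> t\<I>"
abbreviation trels :: "(('r, 'l, 'b \<times> 'b set) gbds_free \<times> ('r, 'l, 'b \<times> 'b set) gbds_free) set"
  where "trels \<equiv> gbds_rels tB \<L> t\<theta> t\<I> treg"
abbreviation tcong ::
    "('r, 'l, 'b \<times> 'b set) gbds_free \<Rightarrow> ('r, 'l, 'b \<times> 'b set) gbds_free \<Rightarrow> bool" (infix "\<simeq>" 50)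
  where "x \<simeq> y \<equiv> rcong tgens trels x y"

lemma tgens_iff [simp]:
  "Proj Y \<in> tgens \<longleftrightarrow> Y \<in> carrier tB"
  "Part \<alpha> Y \<in> tgens \<longleftrightarrow> \<alpha> \<in> \<L> \<and> Y \<in> t\<I> \<alpha>"
  "PartStar \<alpha> Y \<in> tgens \<longleftrightarrow> \<alpha> \<in> \<L> \<and> Y \<in> t\<I> \<alpha>"
  by (auto simp: gbds_gens_def simp del: split_paired_Ex)

lemma tI_diag [simp]: "A \<in> \<I> \<alpha> \<Longrightarrow> (A, cls A) \<in> t\<I> \<alpha>"
  by (auto simp: tI_iff)

lemma tI_carrier: "\<alpha> \<in> \<L> \<Longrightarrow> Y \<in> t\<I> \<alpha> \<Longrightarrow> Y \<in> carrier tB"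
  by (auto simp: tI_iff)

lemma tB_zero_closed: "\<emptyset>\<^bsub>tB\<^esub> \<in> carrier tB"
  by (simp add: tB_zero)

lemma treg_carrier: "Y \<in> treg \<Longrightarrow> Y \<in> carrier tB"
  unfolding gbds_reg_def by blast

lemma trels_closed:
  "(u, v) \<in> trels \<Longrightarrow> u \<in> free_alg tgens \<and> v \<in> free_alg tgens"
  by (induction rule: gbds_rels.induct)
     (auto simp: tB_zero_closed tB_meet_closed tB_join_closed t\<theta>_closed tI_carrier treg_carrier
       gbds_Delta_def treg_iff intro!: free_alg_sum free_alg_mult free_alg_add free_alg_diff)

lemma tpr_meet: "Y \<in> carrier tB \<Longrightarrow> Z \<in> carrier tB \<Longrightarrow> pr Y * pr Z \<simeq> pr (Y \<sqinter>\<^bsub>tB\<^esub> Z)"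
  by (rule rcong_sym, rule rcong_rel[OF gbds_rels.pr_meet])

lemma tpr_join:
  "Y \<in> carrier tB \<Longrightarrow> Z \<in> carrier tB \<Longrightarrow> pr (Y \<squnion>\<^bsub>tB\<^esub> Z) \<simeq> pr Y + pr Z - pr (Y \<sqinter>\<^bsub>tB\<^esub> Z)"
  by (rule rcong_rel[OF gbds_rels.pr_join])

lemma tpr_zero: "pr (\<emptyset>, cls \<emptyset>) \<simeq> 0"
  unfolding tB_zero[symmetric] by (rule rcong_rel[OF gbds_rels.pr_zero])

text \<open>
  The values of \<open>\<phi>\<close> on generators.
\<close>

definition phi_gen :: "('l, 'b) gbds_gen \<Rightarrow> ('r, 'l, 'b \<times> 'b set) gbds_free" where
  "phi_gen g = (case g of
      Proj A \<Rightarrow> pr (A, cls A)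
    | Part \<alpha> B \<Rightarrow> ps \<alpha> (B, cls B)
    | PartStar \<alpha> B \<Rightarrow> ps_star \<alpha> (B, cls B))"

lemma phi_gen_simps [simp]:
  "phi_gen (Proj A) = pr (A, cls A)"
  "phi_gen (Part \<alpha> B) = ps \<alpha> (B, cls B)"
  "phi_gen (PartStar \<alpha> B) = ps_star \<alpha> (B, cls B)"
  by (simp_all add: phi_gen_def)

text \<open>
  The values of \<open>\<psi>\<close> on generators. For a projection, some representative \<open>C\<close> of the second
  coordinate and some regular \<open>W\<close> with \<open>A \<union> W = C \<union> W\<close> are chosen; by \<open>patch_cong\<close> another choice
  gives the same element of the algebra.
\<close>

definition psi_gen :: "('l, 'b \<times> 'b set) gbds_gen \<Rightarrow> ('r, 'l, 'b) gbds_free" where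
  "psi_gen g = (case g of
      Proj Y \<Rightarrow> (let (C, W) = SOME (C, W). C \<in> carrier \<B> \<and> W \<in> reg \<and> snd Y = cls C
          \<and> fst Y \<squnion> W = C \<squnion> W in patch (fst Y) C W)
    | Part \<alpha> Y \<Rightarrow> ps \<alpha> (fst Y)
    | PartStar \<alpha> Y \<Rightarrow> ps_star \<alpha> (fst Y))"

lemma psi_gen_simps [simp]:
  "psi_gen (Part \<alpha> Y) = ps \<alpha> (fst Y)"
  "psi_gen (PartStar \<alpha> Y) = ps_star \<alpha> (fst Y)"
  by (simp_all add: psi_gen_def)

lemma psi_gen_ProjE:
  assumes "A \<in> carrier \<B>" "C \<in> carrier \<B>" "W \<in> reg" "A \<squnion> W = C \<squnion> W"
  obtains C' W' where "C' \<in> carrier \<B>" "W' \<in> reg" "cls C' = cls C" "A \<squnion> W' = C' \<squnion> W'"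
    "psi_gen (Proj (A, cls C)) = patch A C' W'"
proof -
  define P where "P = (\<lambda>(C', W'). C' \<in> carrier \<B> \<and> W' \<in> reg \<and> cls C = cls C'
      \<and> A \<squnion> W' = C' \<squnion> W')"
  obtain C' W' where CW: "(SOME x. P x) = (C', W')"
    by (cases "SOME x. P x")
  have "P (C, W)"
    using assms by (simp add: P_def)
  then have "P (C', W')"
    unfolding CW[symmetric] by (rule someI)
  moreover have "psi_gen (Proj (A, cls C)) = patch A C' W'"
    using CW by (simp add: psi_gen_def P_def)
  ultimately show ?thesis
    using that[of C' W'] by (simp add: P_def)
qed

lemma psi_gen_Proj:
  assumes "A \<in> carrier \<B>" "C \<in> carrier \<B>" "W \<in> reg" "A \<squnion> W = C \<squnion> W"
  shows "psi_gen (Proj (A, cls C)) \<approx> patch A C W"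
proof -
  obtain C' W' where "C' \<in> carrier \<B>" "W' \<in> reg" "cls C' = cls C" "A \<squnion> W' = C' \<squnion> W'"
    "psi_gen (Proj (A, cls C)) = patch A C' W'"
    using assms by (rule psi_gen_ProjE)
  with assms show ?thesis
    by (auto intro: patch_cong)
qed

lemma psi_gen_Proj_diag: "A \<in> carrier \<B> \<Longrightarrow> psi_gen (Proj (A, cls A)) \<approx> pr A"
  using psi_gen_Proj[of A A "\<emptyset>"] by simp

lemma psi_gen_closed:
  assumes g: "g \<in> tgens"
  shows "psi_gen g \<in> free_alg gens"
proof (cases g)
  case (Proj Y)
  with g have "Y \<in> carrier tB"
    by simp
  then obtain A C W where Y: "Y = (A, cls C)"
      and AC: "A \<in> carrier \<B>" "C \<in> carrier \<B>" "W \<in> reg" "A \<squnion> W = C \<squnion> W"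
    by (elim tB_carrierE)
  obtain C' W' where CW: "C' \<in> carrier \<B>" "W' \<in> reg" "cls C' = cls C" "A \<squnion> W' = C' \<squnion> W'"
    "psi_gen (Proj (A, cls C)) = patch A C' W'"
    using AC by (rule psi_gen_ProjE)
  show ?thesis
    using patch_closed[OF AC(1) CW(1,2)] by (simp only: Proj Y CW(5))
next
  case (Part \<alpha> Y)
  with g obtain B where "\<alpha> \<in> \<L>" "B \<in> \<I> \<alpha>" "Y = (B, cls B)"
    by (auto simp: tI_iff)
  then show ?thesis
    by (simp add: Part)
next
  case (PartStar \<alpha> Y)
  with g obtain B where "\<alpha> \<in> \<L>" "B \<in> \<I> \<alpha>" "Y = (B, cls B)"
    by (auto simp: tI_iff)
  then show ?thesis
    by (simp add: PartStar)
qed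

lemma phi_gen_closed: "g \<in> gens \<Longrightarrow> phi_gen g \<in> free_alg tgens"
  by (cases g) auto

text \<open>
  The last defining relation of the associated algebra, for the regular element \<open>(A, \<emptyset>)\<close>.
\<close>

lemma tpr_reg_sum:
  assumes "A \<in> reg"
  shows "pr (A, cls \<emptyset>) \<simeq>
    (\<Sum>\<alpha>\<in>\<Delta> A. ps \<alpha> (\<theta> \<alpha> A, cls (\<theta> \<alpha> A)) * ps_star \<alpha> (\<theta> \<alpha> A, cls (\<theta> \<alpha> A)))"
proof -
  have "(A, cls \<emptyset>) \<in> treg"
    using assms by (auto simp: treg_iff)
  then have "pr (A, cls \<emptyset>) \<simeq> (\<Sum>\<alpha>\<in>gbds_Delta tB \<L> t\<theta> (A, cls \<emptyset>).
      ps \<alpha> (t\<theta> \<alpha> (A, cls \<emptyset>)) * ps_star \<alpha> (t\<theta> \<alpha> (A, cls \<emptyset>)))"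
    by (rule rcong_rel[OF gbds_rels.pr_sum])
  then show ?thesis
    by (simp add: tDelta)
qed

lemma phi_rels_hold: "(u, v) \<in> rels \<Longrightarrow> subst_hom phi_gen u \<simeq> subst_hom phi_gen v"
proof (induction rule: gbds_rels.induct)
  case pr_zero
  then show ?case
    by (simp add: tpr_zero)
next
  case (pr_meet A A')
  then show ?case
    using tpr_meet[of "(A, cls A)" "(A', cls A')", THEN rcong_sym] by (simp add: tB_meet)
next
  case (pr_join A A')
  then show ?case
    using tpr_join[of "(A, cls A)" "(A', cls A')"] by (simp add: tB_meet tB_join)
next
  case (pr_ps A \<alpha> B)
  have "pr (A, cls A) * ps \<alpha> (B, cls B) \<simeq> ps \<alpha> (B, cls B) * pr (t\<theta> \<alpha> (A, cls A))"
    using pr_ps by (intro rcong_rel[OF gbds_rels.pr_ps]) auto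
  then show ?case by simp
next
  case (ps_star_pr A \<alpha> B)
  have "ps_star \<alpha> (B, cls B) * pr (A, cls A) \<simeq> pr (t\<theta> \<alpha> (A, cls A)) * ps_star \<alpha> (B, cls B)"
    using ps_star_pr by (intro rcong_rel[OF gbds_rels.ps_star_pr]) auto
  then show ?case by simp
next
  case (ps_star_ps \<alpha> B \<alpha>' B')
  have "ps_star \<alpha> (B, cls B) * ps \<alpha>' (B', cls B')
      \<simeq> (if \<alpha> = \<alpha>' then pr ((B, cls B) \<sqinter>\<^bsub>tB\<^esub> (B', cls B')) else 0)"
    using ps_star_ps by (intro rcong_rel[OF gbds_rels.ps_star_ps]) auto
  then show ?case
    using ps_star_ps by (simp add: tB_meet split: if_splits)
next
  case (ps_pr \<alpha> B B')
  then have "(B, cls B) \<sqinter>\<^bsub>tB\<^esub> (B', cls B') \<in> t\<I> \<alpha>"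
    by (simp add: tB_meet)
  then have "ps \<alpha> (B, cls B) * pr (B', cls B') \<simeq> ps \<alpha> ((B, cls B) \<sqinter>\<^bsub>tB\<^esub> (B', cls B'))"
    using ps_pr by (intro rcong_rel[OF gbds_rels.ps_pr]) auto
  then show ?case
    using ps_pr by (simp add: tB_meet)
next
  case (pr_ps_star \<alpha> B B')
  then have "(B, cls B) \<sqinter>\<^bsub>tB\<^esub> (B', cls B') \<in> t\<I> \<alpha>"
    by (simp add: tB_meet)
  then have "pr (B', cls B') * ps_star \<alpha> (B, cls B) \<simeq> ps_star \<alpha> ((B, cls B) \<sqinter>\<^bsub>tB\<^esub> (B', cls B'))"
    using pr_ps_star by (intro rcong_rel[OF gbds_rels.pr_ps_star]) auto
  then show ?case
    using pr_ps_star by (simp add: tB_meet)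
next
  case (pr_sum A)
  then have "cls A = cls \<emptyset>"
    using J_reg[OF pr_sum] by (auto simp: cls_eq_iff intro!: bexI[of _ A])
  then show ?case
    using tpr_reg_sum[of A] pr_sum by simp
qed

lemma psi_Proj_meet_join:
  assumes Y: "Y \<in> carrier tB" and Z: "Z \<in> carrier tB"
  shows "psi_gen (Proj Y) * psi_gen (Proj Z) \<approx> psi_gen (Proj (Y \<sqinter>\<^bsub>tB\<^esub> Z))" (is ?meet)
    and "psi_gen (Proj (Y \<squnion>\<^bsub>tB\<^esub> Z))
      \<approx> psi_gen (Proj Y) + psi_gen (Proj Z) - psi_gen (Proj (Y \<sqinter>\<^bsub>tB\<^esub> Z))" (is ?join)
proof -
  obtain A C W1 where
    Y': "Y = (A, cls C)" "A \<in> carrier \<B>" "C \<in> carrier \<B>" "W1 \<in> reg" "A \<squnion> W1 = C \<squnion> W1"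
    using Y by (elim tB_carrierE)
  obtain A' C' W2 where
    Z': "Z = (A', cls C')" "A' \<in> carrier \<B>" "C' \<in> carrier \<B>" "W2 \<in> reg" "A' \<squnion> W2 = C' \<squnion> W2"
    using Z by (elim tB_carrierE)
  \<comment> \<open>The rules for products and joins of patched elements need a common regular \<open>W\<close>.\<close>
  define W where "W = W1 \<squnion> W2"
  have W: "W \<in> reg" "A \<squnion> W = C \<squnion> W" "A' \<squnion> W = C' \<squnion> W"
    using join_eq_mono[OF Y'(5), of W2] join_eq_mono[OF Z'(5), of W1] Y'(2-4) Z'(2-4)
      join_comm[of W1 W2] by (simp_all add: W_def)
  have mW: "(A \<sqinter> A') \<squnion> W = (C \<sqinter> C') \<squnion> W"
    using W Y' Z' by (simp add: join_meet_distrib2)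
  have jW: "(A \<squnion> A') \<squnion> W = (C \<squnion> C') \<squnion> W"
    using W(1) Y'(2,3) Z'(2,3) W(3) join_left_comm[of C A' W] join_left_comm[of A C' W]
      join_left_comm[of C C' W] W(2) by (simp add: join_assoc)
  have psiY: "psi_gen (Proj Y) \<approx> patch A C W" and psiZ: "psi_gen (Proj Z) \<approx> patch A' C' W"
    unfolding Y'(1) Z'(1) using W Y' Z' by (auto intro!: psi_gen_Proj)
  have psim: "psi_gen (Proj (Y \<sqinter>\<^bsub>tB\<^esub> Z)) \<approx> patch (A \<sqinter> A') (C \<sqinter> C') W"
    unfolding Y'(1) Z'(1) using mW W Y' Z' by (subst tB_meet) (auto intro!: psi_gen_Proj)
  have psij: "psi_gen (Proj (Y \<squnion>\<^bsub>tB\<^esub> Z)) \<approx> patch (A \<squnion> A') (C \<squnion> C') W"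
    unfolding Y'(1) Z'(1) using jW W Y' Z' by (subst tB_join) (auto intro!: psi_gen_Proj)
  have "psi_gen (Proj Y) * psi_gen (Proj Z) \<approx> patch A C W * patch A' C' W"
    using psiY psiZ W Y Y' Z' by (intro rcong_mult psi_gen_closed) auto
  also have "\<dots> \<approx> patch (A \<sqinter> A') (C \<sqinter> C') W"
    using W Y' Z' by (intro patch_meet) auto
  also note psim[THEN rcong_sym]
  finally show ?meet .
  note psij
  also have "patch (A \<squnion> A') (C \<squnion> C') W
      \<approx> patch A C W + patch A' C' W - patch (A \<sqinter> A') (C \<sqinter> C') W"
    using W Y' Z' by (intro patch_join) auto
  also have "\<dots> \<approx> psi_gen (Proj Y) + psi_gen (Proj Z) - psi_gen (Proj (Y \<sqinter>\<^bsub>tB\<^esub> Z))"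
    by (intro rcong_add rcong_diff rcong_sym[OF psiY] rcong_sym[OF psiZ] rcong_sym[OF psim])
  finally show ?join .
qed

lemma psi_Proj_reg:
  assumes "A \<in> reg"
  shows "psi_gen (Proj (A, cls \<emptyset>)) \<approx> (\<Sum>\<alpha>\<in>\<Delta> A. ps \<alpha> (\<theta> \<alpha> A) * ps_star \<alpha> (\<theta> \<alpha> A))"
proof -
  have "psi_gen (Proj (A, cls \<emptyset>)) \<approx> patch A \<emptyset> A"
    using assms by (intro psi_gen_Proj) auto
  also have "\<dots> \<approx> pr A + q (A \<sqinter> \<emptyset>) - q (A \<sqinter> A)"
    using assms by (intro patch_conv_q) auto
  also have "\<dots> = pr A + q \<emptyset> - q A"
    using assms by simp
  also have "\<dots> \<approx> pr A + 0 - q A"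
    by (intro rcong_add rcong_diff q_J ideal_zero[OF J_ideal]) auto
  finally show ?thesis
    by (simp add: gap_proj_def)
qed

lemma psi_rels_hold: "(u, v) \<in> trels \<Longrightarrow> subst_hom psi_gen u \<approx> subst_hom psi_gen v"
proof (induction rule: gbds_rels.induct)
  case pr_zero
  have "psi_gen (Proj (\<emptyset>, cls \<emptyset>)) \<approx> pr \<emptyset>"
    by (intro psi_gen_Proj_diag) auto
  also note cong_pr_zero
  finally show ?case
    by (simp add: tB_zero)
next
  case (pr_meet Y Z)
  then show ?case
    using psi_Proj_meet_join(1)[of Y Z, THEN rcong_sym] by simp
next
  case (pr_join Y Z)
  then show ?case
    using psi_Proj_meet_join(2)[of Y Z] by simp
next
  case (pr_ps Y \<alpha> Z)
  obtain A C W where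
    Y: "Y = (A, cls C)" "A \<in> carrier \<B>" "C \<in> carrier \<B>" "W \<in> reg" "A \<squnion> W = C \<squnion> W"
    using pr_ps(1) by (elim tB_carrierE)
  obtain B where B: "B \<in> \<I> \<alpha>" "Z = (B, cls B)"
    using pr_ps by (auto simp: tI_iff)
  have "psi_gen (Proj Y) * ps \<alpha> B \<approx> patch A C W * ps \<alpha> B"
    unfolding Y(1) using Y B pr_ps by (intro rcong_mult_right psi_gen_Proj) auto
  also have "\<dots> \<approx> ps \<alpha> B * pr (\<theta> \<alpha> A)"
    using Y B pr_ps by (intro patch_ps) auto
  also have "\<dots> \<approx> ps \<alpha> B * psi_gen (Proj (\<theta> \<alpha> A, cls (\<theta> \<alpha> A)))"
    using Y B pr_ps by (intro rcong_mult_left rcong_sym[OF psi_gen_Proj_diag]) auto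
  finally show ?case
    by (simp add: Y(1) B(2))
next
  case (ps_star_pr Y \<alpha> Z)
  obtain A C W where
    Y: "Y = (A, cls C)" "A \<in> carrier \<B>" "C \<in> carrier \<B>" "W \<in> reg" "A \<squnion> W = C \<squnion> W"
    using ps_star_pr(1) by (elim tB_carrierE)
  obtain B where B: "B \<in> \<I> \<alpha>" "Z = (B, cls B)"
    using ps_star_pr by (auto simp: tI_iff)
  have "ps_star \<alpha> B * psi_gen (Proj Y) \<approx> ps_star \<alpha> B * patch A C W"
    unfolding Y(1) using Y B ps_star_pr by (intro rcong_mult_left psi_gen_Proj) auto
  also have "\<dots> \<approx> pr (\<theta> \<alpha> A) * ps_star \<alpha> B"
    using Y B ps_star_pr by (intro ps_star_patch) auto
  also have "\<dots> \<approx> psi_gen (Proj (\<theta> \<alpha> A, cls (\<theta> \<alpha> A))) * ps_star \<alpha> B"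
    using Y B ps_star_pr by (intro rcong_mult_right rcong_sym[OF psi_gen_Proj_diag]) auto
  finally show ?case
    by (simp add: Y(1) B(2))
next
  case (ps_star_ps \<alpha> Y \<alpha>' Z)
  obtain B where B: "B \<in> \<I> \<alpha>" "Y = (B, cls B)"
    using ps_star_ps by (auto simp: tI_iff)
  obtain B' where B': "B' \<in> \<I> \<alpha>'" "Z = (B', cls B')"
    using ps_star_ps by (auto simp: tI_iff)
  have "ps_star \<alpha> B * ps \<alpha>' B' \<approx> (if \<alpha> = \<alpha>' then pr (B \<sqinter> B') else 0)"
    using B B' ps_star_ps by (intro cong_ps_star_ps) auto
  also have "\<dots> \<approx> (if \<alpha> = \<alpha>' then psi_gen (Proj (B \<sqinter> B', cls (B \<sqinter> B'))) else 0)"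
    using B B' ps_star_ps psi_gen_Proj_diag[of "B \<sqinter> B'", THEN rcong_sym] by simp
  finally show ?case
    using B B' ps_star_ps by (simp add: tB_meet split: if_splits)
next
  case (ps_pr \<alpha> Y Z)
  obtain B where B: "B \<in> \<I> \<alpha>" "Y = (B, cls B)"
    using ps_pr by (auto simp: tI_iff)
  obtain A C W where Z: "Z = (A, cls C)" "A \<in> carrier \<B>" "C \<in> carrier \<B>"
    using ps_pr(3) by (elim tB_carrierE)
  have YZ: "Y \<sqinter>\<^bsub>tB\<^esub> Z = (B \<sqinter> A, cls (B \<sqinter> A))"
    using ps_pr(1,4) B Z by (auto simp: tB_meet tI_iff)
  have [simp]: "psi_gen (Proj Z) \<in> free_alg gens"
    using ps_pr by (intro psi_gen_closed) auto
  \<comment> \<open>Inserting \<open>p\<^sub>B\<close> reduces the claim to the rule for meets of projections.\<close>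
  have "ps \<alpha> B * psi_gen (Proj Z) \<approx> ps \<alpha> B * pr B * psi_gen (Proj Z)"
    using cong_ps_pr[of \<alpha> B B, THEN rcong_sym] ps_pr(1) B
    by (intro rcong_mult_right) auto
  also have "\<dots> = ps \<alpha> B * (pr B * psi_gen (Proj Z))"
    by (simp add: mult.assoc)
  also have "\<dots> \<approx> ps \<alpha> B * (psi_gen (Proj Y) * psi_gen (Proj Z))"
    unfolding B(2) using B ps_pr(1)
    by (intro rcong_mult_left rcong_mult_right rcong_sym[OF psi_gen_Proj_diag]) auto
  also have "\<dots> \<approx> ps \<alpha> B * psi_gen (Proj (B \<sqinter> A, cls (B \<sqinter> A)))"
    unfolding YZ[symmetric] using B ps_pr by (intro rcong_mult_left psi_Proj_meet_join) auto
  also have "\<dots> \<approx> ps \<alpha> B * pr (B \<sqinter> A)"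
    using B Z ps_pr(1) by (intro rcong_mult_left psi_gen_Proj_diag) auto
  also have "\<dots> \<approx> ps \<alpha> (B \<sqinter> (B \<sqinter> A))"
    using B Z ps_pr(1) by (intro cong_ps_pr) auto
  also have "B \<sqinter> (B \<sqinter> A) = B \<sqinter> A"
    using I_carrier[OF ps_pr(1) B(1)] Z by simp
  finally show ?case
    unfolding YZ by (simp add: B(2))
next
  case (pr_ps_star \<alpha> Y Z)
  obtain B where B: "B \<in> \<I> \<alpha>" "Y = (B, cls B)"
    using pr_ps_star by (auto simp: tI_iff)
  obtain A C W where Z: "Z = (A, cls C)" "A \<in> carrier \<B>" "C \<in> carrier \<B>"
    using pr_ps_star(3) by (elim tB_carrierE)
  have YZ: "Y \<sqinter>\<^bsub>tB\<^esub> Z = (B \<sqinter> A, cls (B \<sqinter> A))"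
    using pr_ps_star(1,4) B Z by (auto simp: tB_meet tI_iff)
  have ZY: "Z \<sqinter>\<^bsub>tB\<^esub> Y = (B \<sqinter> A, cls (B \<sqinter> A))"
    unfolding YZ[symmetric] using I_carrier[OF pr_ps_star(1) B(1)] B Z
    by (simp add: tB_meet meet_comm)
  have [simp]: "psi_gen (Proj Z) \<in> free_alg gens"
    using pr_ps_star by (intro psi_gen_closed) auto
  have "psi_gen (Proj Z) * ps_star \<alpha> B \<approx> psi_gen (Proj Z) * (pr B * ps_star \<alpha> B)"
    using cong_pr_ps_star[of \<alpha> B B, THEN rcong_sym]
      pr_ps_star(1) B
    by (intro rcong_mult_left) auto
  also have "\<dots> = psi_gen (Proj Z) * pr B * ps_star \<alpha> B"
    by (simp add: mult.assoc)
  also have "\<dots> \<approx> psi_gen (Proj Z) * psi_gen (Proj Y) * ps_star \<alpha> B"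
    unfolding B(2) using B pr_ps_star(1)
    by (intro rcong_mult_left rcong_mult_right rcong_sym[OF psi_gen_Proj_diag]) auto
  also have "\<dots> \<approx> psi_gen (Proj (B \<sqinter> A, cls (B \<sqinter> A))) * ps_star \<alpha> B"
    unfolding ZY[symmetric] using B pr_ps_star by (intro rcong_mult_right psi_Proj_meet_join) auto
  also have "\<dots> \<approx> pr (B \<sqinter> A) * ps_star \<alpha> B"
    using B Z pr_ps_star(1) by (intro rcong_mult_right psi_gen_Proj_diag) auto
  also have "\<dots> \<approx> ps_star \<alpha> (B \<sqinter> (B \<sqinter> A))"
    using B Z pr_ps_star(1)
    by (intro cong_pr_ps_star) auto
  also have "B \<sqinter> (B \<sqinter> A) = B \<sqinter> A"
    using I_carrier[OF pr_ps_star(1) B(1)] Z by simp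
  finally show ?case
    unfolding YZ by (simp add: B(2))
next
  case (pr_sum Y)
  then obtain A where A: "A \<in> reg" "Y = (A, cls \<emptyset>)"
    by (auto simp: treg_iff)
  then show ?case
    using psi_Proj_reg[of A] by (simp add: tDelta)
qed

text \<open>
  Under \<open>\<phi>\<close> the gap projections become genuine projections: \<open>(W, [W])\<close> is the disjoint join of
  \<open>(W, \<emptyset>)\<close> and \<open>(\<emptyset>, [W])\<close>, and the former is regular.
\<close>

lemma phi_q:
  assumes "W \<in> reg"
  shows "subst_hom phi_gen (q W) \<simeq> pr (\<emptyset>, cls W)"
proof -
  have mem: "(W, cls \<emptyset>) \<in> carrier tB" "(\<emptyset>, cls W) \<in> carrier tB"
    using assms by (auto intro!: tB_carrierI[of _ _ W])
  have "subst_hom phi_gen (q W) \<simeq> pr (W, cls W) - pr (W, cls \<emptyset>)"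
    using tpr_reg_sum[OF assms, THEN rcong_sym] by (simp add: gap_proj_def rcong_diff)
  also have "\<dots> \<simeq> (pr (W, cls \<emptyset>) + pr (\<emptyset>, cls W) - pr (\<emptyset>, cls \<emptyset>)) - pr (W, cls \<emptyset>)"
    using tpr_join[OF mem] assms by (intro rcong_diff) (auto simp: tB_join tB_meet)
  also have "\<dots> = pr (\<emptyset>, cls W) - pr (\<emptyset>, cls \<emptyset>)"
    by simp
  also have "\<dots> \<simeq> pr (\<emptyset>, cls W) - 0"
    by (intro rcong_diff tpr_zero) auto
  finally show ?thesis by simp
qed

text \<open>
  Here \<open>(A, [A]) \<union> (\<emptyset>, [W \<inter> C]) = (A, [C]) \<union> (\<emptyset>, [W \<inter> A])\<close>, and the two
  meets agree.
\<close>

lemma phi_patch: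
  assumes mem: "A \<in> carrier \<B>" "C \<in> carrier \<B>" "W \<in> reg" and eq: "A \<squnion> W = C \<squnion> W"
  shows "subst_hom phi_gen (patch A C W) \<simeq> pr (A, cls C)"
proof -
  have tmem: "(A, cls C) \<in> carrier tB"
    using assms by (rule tB_carrierI)
  have zmem: "(\<emptyset>, cls X) \<in> carrier tB" if "X \<in> reg" for X
    using that by (intro tB_carrierI[of _ _ X]) auto
  have *: "subst_hom phi_gen (q W) * pr (X, cls X) \<simeq> pr (\<emptyset>, cls (W \<sqinter> X))"
    if "X \<in> carrier \<B>" for X
  proof -
    have "subst_hom phi_gen (q W) * pr (X, cls X) \<simeq> pr (\<emptyset>, cls W) * pr (X, cls X)"
      using mem that by (intro rcong_mult_right phi_q) auto
    also have "\<dots> \<simeq> pr ((\<emptyset>, cls W) \<sqinter>\<^bsub>tB\<^esub> (X, cls X))"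
      using mem that zmem by (intro tpr_meet) auto
    finally show ?thesis
      using mem that by (simp add: tB_meet)
  qed
  have "subst_hom phi_gen (patch A C W)
      = pr (A, cls A) + (subst_hom phi_gen (q W) * pr (C, cls C) - subst_hom phi_gen (q W) * pr (A, cls A))"
    by (simp add: patch_def right_diff_distrib)
  also have "\<dots> \<simeq> pr (A, cls A) + (pr (\<emptyset>, cls (W \<sqinter> C)) - pr (\<emptyset>, cls (W \<sqinter> A)))"
    using mem by (intro rcong_add rcong_diff *) auto
  also have "\<dots> \<simeq> pr (A, cls C)"
  proof -
    have "A \<squnion> (W \<sqinter> C) = C \<squnion> (W \<sqinter> A)"
      using mem eq join_comm[of A C] by (simp add: join_meet_distrib)
    moreover have "A \<sqinter> (W \<sqinter> C) = C \<sqinter> (W \<sqinter> A)"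
      using mem by (simp add: meet_ac)
    moreover have "pr ((A, cls A) \<squnion>\<^bsub>tB\<^esub> (\<emptyset>, cls (W \<sqinter> C))) \<simeq> pr (A, cls A) + pr (\<emptyset>, cls (W \<sqinter> C))
        - pr ((A, cls A) \<sqinter>\<^bsub>tB\<^esub> (\<emptyset>, cls (W \<sqinter> C)))"
      using mem zmem by (intro tpr_join) auto
    moreover have "pr ((A, cls C) \<squnion>\<^bsub>tB\<^esub> (\<emptyset>, cls (W \<sqinter> A))) \<simeq> pr (A, cls C) + pr (\<emptyset>, cls (W \<sqinter> A))
        - pr ((A, cls C) \<sqinter>\<^bsub>tB\<^esub> (\<emptyset>, cls (W \<sqinter> A)))"
      using mem zmem tmem by (intro tpr_join) auto
    ultimately have "pr (A, cls A) + pr (\<emptyset>, cls (W \<sqinter> C)) - pr (\<emptyset>, cls (C \<sqinter> (W \<sqinter> A)))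
        \<simeq> pr (A, cls C) + pr (\<emptyset>, cls (W \<sqinter> A)) - pr (\<emptyset>, cls (C \<sqinter> (W \<sqinter> A)))"
      using mem by (simp add: tB_join tB_meet) (blast intro: rcong_trans rcong_sym)
    then show ?thesis
      by (simp add: rcong_def algebra_simps)
  qed
  finally show ?thesis .
qed

sublocale phi: presentation_hom gens rels tgens trels phi_gen
  using rels_closed trels_closed phi_gen_closed phi_rels_hold by unfold_locales auto

sublocale psi: presentation_hom tgens trels gens rels psi_gen
  using psi_gen_closed psi_rels_hold by unfold_locales auto

abbreviation phi where "phi \<equiv> pres_hom tgens trels phi_gen"
abbreviation psi where "psi \<equiv> pres_hom gens rels psi_gen"

lemma psi_phi: "X \<in> carrier (presented_algebra gens rels) \<Longrightarrow> psi (phi X) = X"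
proof (rule pres_hom_left_inverse[OF phi.presentation_hom_axioms psi.presentation_hom_axioms])
  fix g assume "g \<in> gens"
  then show "subst_hom psi_gen (phi_gen g) \<approx> free_var g"
    by (cases g) (auto simp: psi_gen_Proj_diag)
qed

lemma phi_psi: "Y \<in> carrier (presented_algebra tgens trels) \<Longrightarrow> phi (psi Y) = Y"
proof (rule pres_hom_left_inverse[OF psi.presentation_hom_axioms phi.presentation_hom_axioms])
  fix g assume g: "g \<in> tgens"
  show "subst_hom phi_gen (psi_gen g) \<simeq> free_var g"
  proof (cases g)
    case (Proj Y)
    then obtain A C W where Y: "Y = (A, cls C)"
        and AC: "A \<in> carrier \<B>" "C \<in> carrier \<B>" "W \<in> reg" "A \<squnion> W = C \<squnion> W"
      using g by (auto elim: tB_carrierE)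
    obtain C' W' where CW: "C' \<in> carrier \<B>" "W' \<in> reg" "cls C' = cls C" "A \<squnion> W' = C' \<squnion> W'"
      "psi_gen (Proj (A, cls C)) = patch A C' W'"
      using AC by (rule psi_gen_ProjE)
    show ?thesis
      using phi_patch[OF AC(1) CW(1,2,4)] by (simp only: Proj Y CW(3,5))
  qed (use g in \<open>auto simp: tI_iff\<close>)
qed

text \<open>
  The relative complements \<open>C = B \<setminus> A\<close> and \<open>D = A \<setminus> B\<close> are regular because they lie below
  any \<open>W\<close> that witnesses the congruence of \<open>A\<close> and \<open>B\<close>.
\<close>

lemma split_exists:
  assumes mem: "A \<in> carrier \<B>" "B \<in> carrier \<B>" and "(A, cls B) \<in> carrier tB"
  shows "\<exists>C D. C \<in> reg \<and> D \<in> reg \<and> A \<squnion> C = B \<squnion> D \<and> A \<sqinter> C = \<emptyset> \<and> B \<sqinter> D = \<emptyset>"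
proof -
  obtain W where W: "W \<in> reg" "A \<squnion> W = B \<squnion> W"
    using assms by (auto simp: tB_carrier_iff)
  have diff_reg: "Y \<setminus> X \<in> reg"
    if "X \<in> carrier \<B>" "Y \<in> carrier \<B>" "X \<squnion> W = Y \<squnion> W" for X Y
  proof -
    have "(Y \<setminus> X) \<sqinter> Y = Y \<setminus> X"
      using that diff_join[of Y X] meet_absorb[of "Y \<setminus> X" "Y \<sqinter> X"] by simp
    then have "Y \<setminus> X = ((Y \<setminus> X) \<sqinter> Y) \<squnion> ((Y \<setminus> X) \<sqinter> W)"
      using that W join_absorb[of "Y \<setminus> X" W] by simp
    also have "\<dots> = (Y \<setminus> X) \<sqinter> (Y \<squnion> W)"
      using that W by (simp add: meet_join_distrib)
    also have "\<dots> = (Y \<setminus> X) \<sqinter> (X \<squnion> W)"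
      by (simp only: that(3))
    also have "\<dots> = (Y \<setminus> X) \<sqinter> W"
      using that(1,2) W(1) by (simp add: meet_join_distrib diff_meet)
    finally show ?thesis
      using that W reg_meet2[of W "Y \<setminus> X"] by simp
  qed
  have join_diff: "X \<squnion> (Y \<setminus> X) = X \<squnion> Y" if "X \<in> carrier \<B>" "Y \<in> carrier \<B>" for X Y
  proof -
    have "X \<squnion> Y = X \<squnion> ((Y \<setminus> X) \<squnion> (Y \<sqinter> X))"
      using that by (simp add: diff_join)
    also have "\<dots> = (X \<squnion> (X \<sqinter> Y)) \<squnion> (Y \<setminus> X)"
      using that by (simp add: join_ac meet_comm)
    finally show ?thesis
      using that by (simp add: join_absorb)
  qed
  have "A \<squnion> (B \<setminus> A) = B \<squnion> (A \<setminus> B)"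
    using mem by (simp add: join_diff join_comm[of A B])
  moreover have "A \<sqinter> (B \<setminus> A) = \<emptyset>" "B \<sqinter> (A \<setminus> B) = \<emptyset>"
    using mem diff_meet meet_comm diff_closed by metis+
  moreover note diff_reg[OF mem W(2)] diff_reg[OF mem(2,1) W(2)[symmetric]]
  ultimately show ?thesis
    by blast
qed

lemma psi_gen_Proj_split:
  assumes "A \<in> carrier \<B>" "B \<in> carrier \<B>" "C \<in> reg" "D \<in> reg"
    "A \<squnion> C = B \<squnion> D" "A \<sqinter> C = \<emptyset>" "B \<sqinter> D = \<emptyset>"
  shows "psi_gen (Proj (A, cls B)) \<approx> pr A + q C - q D"
proof -
  have "psi_gen (Proj (A, cls B)) \<approx> patch A B (C \<squnion> D)"
    using assms patch_split(1)[OF assms] by (intro psi_gen_Proj) auto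
  also note patch_split(2)[OF assms]
  finally show ?thesis .
qed

end


theorem theorem4p1:
  fixes \<B> :: "'b gba"
    and \<L> :: "'l set"
    and \<theta> :: "'l \<Rightarrow> 'b \<Rightarrow> 'b"
    and \<I> :: "'l \<Rightarrow> 'b set"
    and \<J> :: "'b set"
  assumes "relative_gbds \<B> \<L> \<theta> \<I> \<J>"
  shows
    "let reg = gbds_reg \<B> \<L> \<theta>;
         J = gba_class \<B> \<J>;
         tB = assoc_gba \<B> \<L> \<theta> \<J>;
         t\<theta> = assoc_theta \<B> \<J> \<theta>;
         t\<I> = assoc_ideal \<B> \<J> \<I>;
         treg = gbds_reg tB \<L> t\<theta>;
         alg = gbds_alg \<B> \<L> \<theta> \<I> \<J>;
         talg = gbds_alg tB \<L> t\<theta> t\<I> treg;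
         cl = gbds_class \<B> \<L> \<theta> \<I> \<J>;
         tcl = gbds_class tB \<L> t\<theta> t\<I> treg;
         q = gap_proj \<B> \<L> \<theta>;
         split = (\<lambda>A B C D. C \<in> reg \<and> D \<in> reg \<and>
           A \<squnion>\<^bsub>\<B>\<^esub> C = B \<squnion>\<^bsub>\<B>\<^esub> D \<and> A \<sqinter>\<^bsub>\<B>\<^esub> C = \<emptyset>\<^bsub>\<B>\<^esub> \<and> B \<sqinter>\<^bsub>\<B>\<^esub> D = \<emptyset>\<^bsub>\<B>\<^esub>)
     in \<exists>(\<phi> :: ('r::{comm_ring, comm_monoid_mult}, 'l, 'b) gbds_free set
              \<Rightarrow> ('r, 'l, 'b \<times> 'b set) gbds_free set)
         (\<psi> :: ('r, 'l, 'b \<times> 'b set) gbds_free set \<Rightarrow> ('r, 'l, 'b) gbds_free set).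
          algebra_iso alg talg \<phi> \<and>
          algebra_iso talg alg \<psi> \<and>
          (\<forall>x\<in>carrier alg. \<psi> (\<phi> x) = x) \<and>
          (\<forall>y\<in>carrier talg. \<phi> (\<psi> y) = y) \<and>
          (\<forall>A\<in>carrier \<B>. \<phi> (cl (pr A)) = tcl (pr (A, J A))) \<and>
          (\<forall>\<alpha>\<in>\<L>. \<forall>B\<in>\<I> \<alpha>.
             \<phi> (cl (ps \<alpha> B)) = tcl (ps \<alpha> (B, J B)) \<and>
             \<phi> (cl (ps_star \<alpha> B)) = tcl (ps_star \<alpha> (B, J B))) \<and>
          (\<forall>A\<in>carrier \<B>. \<forall>B\<in>carrier \<B>. (A, J B) \<in> carrier tB \<longrightarrow>
             (\<exists>C D. split A B C D) \<and>
             (\<forall>C D. split A B C D \<longrightarrow>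
                \<psi> (tcl (pr (A, J B))) = cl (pr A + q C - q D))) \<and>
          (\<forall>\<alpha>\<in>\<L>. \<forall>A\<in>\<I> \<alpha>.
             \<psi> (tcl (ps \<alpha> (A, J A))) = cl (ps \<alpha> A) \<and>
             \<psi> (tcl (ps_star \<alpha> (A, J A))) = cl (ps_star \<alpha> A))"
proof -
  interpret relative_gbds_algebra \<B> \<L> \<theta> \<I> \<J> "TYPE('r)"
    using assms by (simp add: relative_gbds_algebra_def)
  have bij: "bij_betw phi (carrier (presented_algebra gens rels)) (carrier (presented_algebra tgens trels))"
    "bij_betw psi (carrier (presented_algebra tgens trels)) (carrier (presented_algebra gens rels))"
    using phi.pres_hom_closed psi.pres_hom_closed psi_phi phi_psi
    by (auto intro!: bij_betwI[of _ _ _ psi] bij_betwI[of _ _ _ phi])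
  show ?thesis
    unfolding Let_def gbds_alg_def gbds_class_def
    by (intro exI[of _ phi] exI[of _ psi] conjI ballI allI impI phi.pres_hom_iso psi.pres_hom_iso bij
        psi_phi phi_psi split_exists)
       (auto simp: phi.pres_hom_class psi.pres_hom_class pres_class_eq_iff intro!: psi_gen_Proj_split)
qed

end
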